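(* Let $\mathfrak{g}$ be a compact real Lie algebra with root system $\Delta$, positive roots $\Delta_+$, simple roots $\Pi$, and level function $\ell(\cdot)$. For every $\alpha\in\Delta_+\setminus\Pi$ fix a decomposition $\alpha=\zeta_\alpha+\eta_\alpha$ with $\zeta_\alpha,\eta_\alpha\in\Delta_+$, and let $(X_\alpha)$ be a Chevalley basis of $\mathfrak{g}^{\mathbb{C}}$ with $X_{-\alpha}=-\overline{X_\alpha}$ for all $\alpha\in\Delta_+$ and $c_{\zeta_\alpha,\eta_\alpha}>0$ for all $\alpha\in\Delta_+\setminus\Pi$. Then for all $\alpha,\beta\in\Delta_+$ the following algorithm computes the corresponding Chevalley constants $c_{\alpha,\beta}$ correctly. (C1) For all $\alpha,\beta\in\Delta_+$ with $\alpha+\beta\notin\Delta_+$ put $c_{\alpha,\beta}:=0$. (C2) Iterate steps (C3)--(C8) for $\ell=2,\dots,L$, where $L$ is the maximal level of roots in $\Delta$. (C3) Iterate steps (C4)--(C8) with $\alpha$ running through all positive roots of level $\ell$. (C4) Set $\zeta:=\zeta_\alpha$ and $\eta:=\eta_\alpha$. (C5) Let $p$ be the smallest non-negative integer so that $\eta-(p+1)\zeta\notin\Delta$, and put $q:=p-2\,\langle\eta,\zeta\rangle/\|\zeta\|^2$, $c_{\zeta,\eta}:=\sqrt{\tfrac{q(1+p)}2}\,\|\zeta\|$ and $c_{\eta,\zeta}:=-c_{\zeta,\eta}$. (C6) Iterate step (C7) for all pairs $(\gamma,\delta)$ of positive roots with $\gamma+\delta=\alpha$ and $\gamma,\delta\notin\{\zeta,\eta\}$.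 (C7) Put $$c_{11}:=\begin{cases}c_{\eta,\gamma-\eta}&\text{if }\gamma-\eta\in\Delta_+\\c_{\gamma,\eta-\gamma}&\text{if }\gamma-\eta\in-\Delta_+\\0&\text{otherwise}\end{cases},\qquad c_{12}:=\begin{cases}c_{\delta,\zeta-\delta}&\text{if }\zeta-\delta\in\Delta_+\\c_{\zeta,\delta-\zeta}&\text{if }\zeta-\delta\in-\Delta_+\\0&\text{otherwise}\end{cases},$$ $$c_{21}:=\begin{cases}c_{\zeta-\gamma,\gamma}&\text{if }\zeta-\gamma\in\Delta_+\\c_{\gamma-\zeta,\zeta}&\text{if }\zeta-\gamma\in-\Delta_+\\0&\text{otherwise}\end{cases},\qquad c_{22}:=\begin{cases}c_{\eta,\delta-\eta}&\text{if }\delta-\eta\in\Delta_+\\c_{\delta,\eta-\delta}&\text{if }\delta-\eta\in-\Delta_+\\0&\text{otherwise}\end{cases},$$ and then $c_{\gamma,\delta}:=\tfrac1{c_{\zeta,\eta}}\,(c_{11}c_{12}+c_{21}c_{22})$. (C8) (End of loops.)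
   Context: A compact real Lie algebra here means a real Lie algebra with negative definite Killing form $\kappa$. $\mathfrak{t}$ is a Cartan subalgebra, $\Delta\subset(\mathfrak{t}^{\mathbb{C}})^*$ the root system of $\mathfrak{g}^{\mathbb{C}}$ with respect to $\mathfrak{t}^{\mathbb{C}}$ with root spaces $\mathfrak{g}^{\mathbb{C}}_\alpha$, $X\mapsto\overline X$ the conjugation of $\mathfrak{g}^{\mathbb{C}}$ with respect to $\mathfrak{g}$, and $\kappa$ also the Killing form of $\mathfrak{g}^{\mathbb{C}}$. For $\alpha\in\Delta$, $\alpha^\sharp\in i\mathfrak{t}$ satisfies $\kappa(\alpha^\sharp,\cdot)=\alpha$ on $\mathfrak{t}$; $\langle\alpha,\beta\rangle:=\kappa(\alpha^\sharp,\beta^\sharp)$, $\|\alpha\|^2=\langle\alpha,\alpha\rangle$. The level of a root $\beta=\sum_{\alpha\in\Pi}k_\alpha\alpha$ is $\ell(\beta)=\sum_{\alpha\in\Pi}k_\alpha$. A family $(X_\alpha)_{\alpha\in\Delta}$, $X_\alpha\in\mathfrak{g}^{\mathbb{C}}_\alpha$, is a Chevalley basis of $\mathfrak{g}^{\mathbb{C}}$ if there are real numbers $c_{\alpha,\beta}$ (Chevalley constants) such that $[X_\alpha,X_\beta]=c_{\alpha,\beta}X_{\alpha+\beta}$ if $\alpha+\beta\in\Delta$; $[X_\alpha,X_{-\alpha}]=\alpha^\sharp$; $[X_\alpha,X_\beta]=0$ otherwise; and $c_{-\alpha,-\beta}=-c_{\alpha,\beta}$. One puts $c_{\alpha,\beta}:=0$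 whenever $\alpha+\beta\notin\Delta\cup\{0\}$. *)

theory Defs
  imports "HOL-Analysis.Analysis" "HOL-Library.Function_Algebras"
begin

section \<open>Traces, Killing form and compact Lie algebras\<close>

text \<open>Independent of the chosen basis for every linear endomorphism of a finite-dimensional space,
  the only case in which it is used.\<close>

definition endo_trace ::
    "('f::field \<Rightarrow> 'v::ab_group_add \<Rightarrow> 'v) \<Rightarrow> ('v \<Rightarrow> 'v) \<Rightarrow> 'f" where
  "endo_trace smul f =
     (let B = (SOME B. \<not> module.dependent smul B \<and> module.span smul B = UNIV)
      in \<Sum>b\<in>B. module.representation smul B (f b) b)"

definition killing ::
    "('f::field \<Rightarrow> 'v::ab_group_add \<Rightarrow> 'v) \<Rightarrow> ('v \<Rightarrow> 'v \<Rightarrow> 'v) \<Rightarrow> 'v \<Rightarrow> 'v \<Rightarrow> 'f" where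
  "killing smul br x y = endo_trace smul (\<lambda>z. br x (br y z))"

definition real_lie_algebra :: "('g::real_vector \<Rightarrow> 'g \<Rightarrow> 'g) \<Rightarrow> bool" where
  "real_lie_algebra br \<longleftrightarrow>
     (\<exists>B::'g set. finite B \<and> span B = UNIV) \<and>
     bilinear br \<and>
     (\<forall>x. br x x = 0) \<and>
     (\<forall>x y z. br x (br y z) + br y (br z x) + br z (br x y) = 0)"

definition compact_lie_algebra :: "('g::real_vector \<Rightarrow> 'g \<Rightarrow> 'g) \<Rightarrow> bool" where
  "compact_lie_algebra br \<longleftrightarrow>
     real_lie_algebra br \<and> (\<forall>x. x \<noteq> 0 \<longrightarrow> killing (*\<^sub>R) br x x < 0)"

section \<open>Cartan subalgebras\<close>

definition lie_subalgebra :: "('g::real_vector \<Rightarrow> 'g \<Rightarrow> 'g) \<Rightarrow> 'g set \<Rightarrow> bool" where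
  "lie_subalgebra br S \<longleftrightarrow> subspace S \<and> (\<forall>x\<in>S. \<forall>y\<in>S. br x y \<in> S)"

primrec lower_central :: "('g::real_vector \<Rightarrow> 'g \<Rightarrow> 'g) \<Rightarrow> 'g set \<Rightarrow> nat \<Rightarrow> 'g set" where
  "lower_central br S 0 = S"
| "lower_central br S (Suc n) = span {br x y | x y. x \<in> S \<and> y \<in> lower_central br S n}"

definition nilpotent_subalgebra :: "('g::real_vector \<Rightarrow> 'g \<Rightarrow> 'g) \<Rightarrow> 'g set \<Rightarrow> bool" where
  "nilpotent_subalgebra br S \<longleftrightarrow> lie_subalgebra br S \<and> (\<exists>n. lower_central br S n = {0})"

definition normalizer :: "('g \<Rightarrow> 'g \<Rightarrow> 'g) \<Rightarrow> 'g set \<Rightarrow> 'g set" where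
  "normalizer br S = {x. \<forall>y\<in>S. br x y \<in> S}"

definition cartan_subalgebra :: "('g::real_vector \<Rightarrow> 'g \<Rightarrow> 'g) \<Rightarrow> 'g set \<Rightarrow> bool" where
  "cartan_subalgebra br t \<longleftrightarrow> nilpotent_subalgebra br t \<and> normalizer br t = t"

section \<open>Complexification\<close>

text \<open>The pair \<open>(x, y)\<close> stands for \<open>x + i y\<close>; addition is componentwise.\<close>

type_synonym 'g cplx = "'g \<times> 'g"

definition cscale :: "complex \<Rightarrow> 'g::real_vector cplx \<Rightarrow> 'g cplx" where
  "cscale z X = (Re z *\<^sub>R fst X - Im z *\<^sub>R snd X, Re z *\<^sub>R snd X + Im z *\<^sub>R fst X)"

lemma vector_space_cscale: "vector_space (cscale :: complex \<Rightarrow> 'g::real_vector cplx \<Rightarrow> 'g cplx)"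
  by unfold_locales (auto simp: cscale_def algebra_simps)

definition cbr :: "('g::real_vector \<Rightarrow> 'g \<Rightarrow> 'g) \<Rightarrow> 'g cplx \<Rightarrow> 'g cplx \<Rightarrow> 'g cplx" where
  "cbr br X Y = (br (fst X) (fst Y) - br (snd X) (snd Y), br (fst X) (snd Y) + br (snd X) (fst Y))"

definition conjugate :: "'g::real_vector cplx \<Rightarrow> 'g cplx" where
  "conjugate X = (fst X, - snd X)"

definition ckilling :: "('g::real_vector \<Rightarrow> 'g \<Rightarrow> 'g) \<Rightarrow> 'g cplx \<Rightarrow> 'g cplx \<Rightarrow> complex" where
  "ckilling br = killing cscale (cbr br)"

section \<open>Roots\<close>

text \<open>With \<open>t\<^sup>\<complex> = t \<times> t\<close>, a functional on \<open>t\<^sup>\<complex>\<close> is represented by its extension by \<open>0\<close>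
  to all of \<open>g\<^sup>\<complex>\<close>, so that equality, sums and differences of functionals are those of functions.\<close>

type_synonym 'g weight = "'g cplx \<Rightarrow> complex"

definition weights :: "'g::real_vector set \<Rightarrow> 'g weight set" where
  "weights t = {\<alpha>.
     (\<forall>H\<in>t \<times> t. \<forall>K\<in>t \<times> t. \<alpha> (H + K) = \<alpha> H + \<alpha> K) \<and>
     (\<forall>z. \<forall>H\<in>t \<times> t. \<alpha> (cscale z H) = z * \<alpha> H) \<and>
     (\<forall>H. H \<notin> t \<times> t \<longrightarrow> \<alpha> H = 0)}"

definition rscale :: "real \<Rightarrow> 'g weight \<Rightarrow> 'g weight" where
  "rscale r \<alpha> = (\<lambda>H. of_real r * \<alpha> H)"

lemma vector_space_rscale: "vector_space (rscale :: real \<Rightarrow> 'g weight \<Rightarrow> 'g weight)"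
  by unfold_locales (auto simp: rscale_def fun_eq_iff algebra_simps)

definition root_space ::
    "('g::real_vector \<Rightarrow> 'g \<Rightarrow> 'g) \<Rightarrow> 'g set \<Rightarrow> 'g weight \<Rightarrow> 'g cplx set" where
  "root_space br t \<alpha> = {X. \<forall>H\<in>t \<times> t. cbr br H X = cscale (\<alpha> H) X}"

definition roots :: "('g::real_vector \<Rightarrow> 'g \<Rightarrow> 'g) \<Rightarrow> 'g set \<Rightarrow> 'g weight set" where
  "roots br t = {\<alpha> \<in> weights t. \<alpha> \<noteq> 0 \<and> root_space br t \<alpha> \<noteq> {0}}"

definition sharp :: "('g::real_vector \<Rightarrow> 'g \<Rightarrow> 'g) \<Rightarrow> 'g set \<Rightarrow> 'g weight \<Rightarrow> 'g cplx" where
  "sharp br t \<alpha> = (THE A. A \<in> {0} \<times> t \<and> (\<forall>H\<in>t. ckilling br A (H, 0) = \<alpha> (H, 0)))"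

text \<open>The Killing form is real on \<open>i t\<close>.\<close>

definition root_inner ::
    "('g::real_vector \<Rightarrow> 'g \<Rightarrow> 'g) \<Rightarrow> 'g set \<Rightarrow> 'g weight \<Rightarrow> 'g weight \<Rightarrow> real" where
  "root_inner br t \<alpha> \<beta> = Re (ckilling br (sharp br t \<alpha>) (sharp br t \<beta>))"

definition int_comb :: "'g weight set \<Rightarrow> ('g weight \<Rightarrow> int) \<Rightarrow> 'g weight" where
  "int_comb \<Psi> k = (\<Sum>\<alpha>\<in>\<Psi>. rscale (of_int (k \<alpha>)) \<alpha>)"

text \<open>\<open>\<Psi>\<close> is a system of simple roots (usually written as capital Pi, which is a binder here).\<close>

definition root_base :: "'g weight set \<Rightarrow> 'g weight set \<Rightarrow> bool" where
  "root_base \<Delta> \<Psi> \<longleftrightarrow>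
     finite \<Psi> \<and> \<Psi> \<subseteq> \<Delta> \<and>
     \<not> module.dependent rscale \<Psi> \<and> module.span rscale \<Psi> = module.span rscale \<Delta> \<and>
     (\<forall>\<beta>\<in>\<Delta>. \<exists>k. \<beta> = int_comb \<Psi> k \<and> ((\<forall>\<alpha>\<in>\<Psi>. k \<alpha> \<ge> 0) \<or> (\<forall>\<alpha>\<in>\<Psi>. k \<alpha> \<le> 0)))"

definition positive_roots :: "'g weight set \<Rightarrow> 'g weight set \<Rightarrow> 'g weight set" where
  "positive_roots \<Delta> \<Psi> = {\<beta>\<in>\<Delta>. \<exists>k. \<beta> = int_comb \<Psi> k \<and> (\<forall>\<alpha>\<in>\<Psi>. k \<alpha> \<ge> 0)}"

definition level :: "'g weight set \<Rightarrow> 'g weight \<Rightarrow> int" where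
  "level \<Psi> \<beta> = (THE n. \<exists>k. \<beta> = int_comb \<Psi> k \<and> n = (\<Sum>\<alpha>\<in>\<Psi>. k \<alpha>))"

section \<open>Chevalley bases\<close>

text \<open>\<open>X\<close> is a Chevalley basis with Chevalley constants \<open>c\<close>. Only values on \<open>\<Delta> \<times> \<Delta>\<close> matter, and
  \<open>c \<alpha> (- \<alpha>)\<close> is left unconstrained.\<close>

definition chevalley_basis ::
    "('g::real_vector \<Rightarrow> 'g \<Rightarrow> 'g) \<Rightarrow> 'g set \<Rightarrow> ('g weight \<Rightarrow> 'g cplx) \<Rightarrow>
     ('g weight \<Rightarrow> 'g weight \<Rightarrow> real) \<Rightarrow> bool" where
  "chevalley_basis br t X c \<longleftrightarrow> (let \<Delta> = roots br t in
     (\<forall>\<alpha>\<in>\<Delta>. X \<alpha> \<in> root_space br t \<alpha>) \<and>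
     (\<forall>\<alpha>\<in>\<Delta>. cbr br (X \<alpha>) (X (- \<alpha>)) = sharp br t \<alpha>) \<and>
     (\<forall>\<alpha>\<in>\<Delta>. \<forall>\<beta>\<in>\<Delta>. \<alpha> + \<beta> \<in> \<Delta> \<longrightarrow>
        cbr br (X \<alpha>) (X \<beta>) = cscale (of_real (c \<alpha> \<beta>)) (X (\<alpha> + \<beta>)) \<and>
        c (- \<alpha>) (- \<beta>) = - c \<alpha> \<beta>) \<and>
     (\<forall>\<alpha>\<in>\<Delta>. \<forall>\<beta>\<in>\<Delta>. \<alpha> + \<beta> \<notin> \<Delta> \<union> {0} \<longrightarrow>
        cbr br (X \<alpha>) (X \<beta>) = 0 \<and> c \<alpha> \<beta> = 0))"

section \<open>The algorithm\<close>

text \<open>The state of the algorithm is the table of the constants. Parameters: \<open>P\<close> is the set of positive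
  roots, \<open>ip\<close> the scalar product of roots, \<open>\<zeta>\<close> and \<open>\<eta>\<close> the summands of \<open>\<alpha>\<close>.\<close>

type_synonym 'g ctable = "'g weight \<Rightarrow> 'g weight \<Rightarrow> real"

definition set_entry :: "'g weight \<Rightarrow> 'g weight \<Rightarrow> real \<Rightarrow> 'g ctable \<Rightarrow> 'g ctable" where
  "set_entry \<alpha> \<beta> v c = c(\<alpha> := (c \<alpha>)(\<beta> := v))"

definition init_table :: "'g weight set \<Rightarrow> 'g ctable \<Rightarrow> 'g ctable" where
  "init_table P c = (\<lambda>\<alpha> \<beta>. if \<alpha> \<in> P \<and> \<beta> \<in> P \<and> \<alpha> + \<beta> \<notin> P then 0 else c \<alpha> \<beta>)"

definition decomposition_step ::
    "'g weight set \<Rightarrow> ('g weight \<Rightarrow> 'g weight \<Rightarrow> real) \<Rightarrow> 'g weight \<Rightarrow> 'g weight \<Rightarrow>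
     'g ctable \<Rightarrow> 'g ctable" where
  "decomposition_step \<Delta> ip \<zeta> \<eta> c =
     (let p = real (LEAST p::nat. \<eta> - rscale (real (p + 1)) \<zeta> \<notin> \<Delta>);
          q = p - 2 * ip \<eta> \<zeta> / ip \<zeta> \<zeta>;
          v = sqrt (q * (1 + p) / 2) * sqrt (ip \<zeta> \<zeta>)
      in set_entry \<eta> \<zeta> (- v) (set_entry \<zeta> \<eta> v c))"

definition other_pairs ::
    "'g weight set \<Rightarrow> 'g weight \<Rightarrow> 'g weight \<Rightarrow> 'g weight \<Rightarrow> ('g weight \<times> 'g weight) set" where
  "other_pairs P \<zeta> \<eta> \<alpha> =
     {(\<gamma>, \<delta>). \<gamma> \<in> P \<and> \<delta> \<in> P \<and> \<gamma> + \<delta> = \<alpha> \<and> \<gamma> \<notin> {\<zeta>, \<eta>} \<and> \<delta> \<notin> {\<zeta>, \<eta>}}"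

definition pair_step ::
    "'g weight set \<Rightarrow> 'g weight \<Rightarrow> 'g weight \<Rightarrow> 'g weight \<times> 'g weight \<Rightarrow>
     'g ctable \<Rightarrow> 'g ctable" where
  "pair_step P \<zeta> \<eta> = (\<lambda>(\<gamma>, \<delta>) c.
     let c11 = (if \<gamma> - \<eta> \<in> P then c \<eta> (\<gamma> - \<eta>)
                else if \<gamma> - \<eta> \<in> uminus ` P then c \<gamma> (\<eta> - \<gamma>) else 0);
         c12 = (if \<zeta> - \<delta> \<in> P then c \<delta> (\<zeta> - \<delta>)
                else if \<zeta> - \<delta> \<in> uminus ` P then c \<zeta> (\<delta> - \<zeta>) else 0);
         c21 = (if \<zeta> - \<gamma> \<in> P then c (\<zeta> - \<gamma>) \<gamma>
                else if \<zeta> - \<gamma> \<in> uminus ` P then c (\<gamma> - \<zeta>) \<zeta> else 0);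
         c22 = (if \<delta> - \<eta> \<in> P then c \<eta> (\<delta> - \<eta>)
                else if \<delta> - \<eta> \<in> uminus ` P then c \<delta> (\<eta> - \<delta>) else 0)
     in set_entry \<gamma> \<delta> (1 / c \<zeta> \<eta> * (c11 * c12 + c21 * c22)) c)"

text \<open>The orders in which the loops over the roots of one level and over the other decompositions of
  a root run are not prescribed. They are given by lists: \<open>ro l\<close> enumerates the positive
  roots of level \<open>l\<close>, and \<open>po \<alpha>\<close> the pairs visited for \<open>\<alpha>\<close>.\<close>

definition root_loop ::
    "'g weight set \<Rightarrow> 'g weight set \<Rightarrow> ('g weight \<Rightarrow> 'g weight \<Rightarrow> real) \<Rightarrow>
     ('g weight \<Rightarrow> 'g weight) \<Rightarrow> ('g weight \<Rightarrow> 'g weight) \<Rightarrow>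
     ('g weight \<Rightarrow> ('g weight \<times> 'g weight) list) \<Rightarrow> 'g weight list \<Rightarrow> 'g ctable \<Rightarrow> 'g ctable" where
  "root_loop \<Delta> P ip \<zeta> \<eta> po =
     fold (\<lambda>\<alpha> c. fold (pair_step P (\<zeta> \<alpha>) (\<eta> \<alpha>)) (po \<alpha>) (decomposition_step \<Delta> ip (\<zeta> \<alpha>) (\<eta> \<alpha>) c))"

text \<open>\<open>chevalley_run br t \<Psi> \<zeta> \<eta> c0 c'\<close>: started with the (uninitialised, hence arbitrary) table \<open>c0\<close>,
  some execution of the algorithm ends with the table \<open>c'\<close>.\<close>

definition chevalley_run ::
    "('g::real_vector \<Rightarrow> 'g \<Rightarrow> 'g) \<Rightarrow> 'g set \<Rightarrow> 'g weight set \<Rightarrow>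
     ('g weight \<Rightarrow> 'g weight) \<Rightarrow> ('g weight \<Rightarrow> 'g weight) \<Rightarrow> 'g ctable \<Rightarrow> 'g ctable \<Rightarrow> bool" where
  "chevalley_run br t \<Psi> \<zeta> \<eta> c0 c' \<longleftrightarrow>
     (let \<Delta> = roots br t; P = positive_roots \<Delta> \<Psi>; L = Max (level \<Psi> ` \<Delta>) in
      \<exists>ro po.
        (\<forall>l\<in>{2..L}. distinct (ro l) \<and> set (ro l) = {\<alpha>\<in>P. level \<Psi> \<alpha> = l}) \<and>
        (\<forall>\<alpha>\<in>P. level \<Psi> \<alpha> \<ge> 2 \<longrightarrow>
           distinct (po \<alpha>) \<and> set (po \<alpha>) = other_pairs P (\<zeta> \<alpha>) (\<eta> \<alpha>) \<alpha>) \<and>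
        c' = fold (\<lambda>l. root_loop \<Delta> P (root_inner br t) \<zeta> \<eta> po (ro l)) [2..L] (init_table P c0))"

end

(* The normalisation [X_a, X_-a] = a^sharp means kappa(X_a, X_-a) = 1. Invariance of kappa then gives
   c_{a,b} = c_{b,c} whenever a + b + c = 0, and pairing the Jacobi identity for X_zeta, X_eta,
   X_-gamma with X_-delta gives the identity behind (C7). Evaluating
   ad zeta^sharp = [ad X_zeta, ad X_-zeta] on X_b expresses c_{zeta,b-zeta}^2 - c_{zeta,b}^2 as a scalar
   product of roots; summing along the zeta-string through eta yields the formula in (C5), and no
   representation theory of sl_2 or one-dimensionality of root spaces is needed. The entries read in
   (C7) belong to roots of smaller level, so every value written is correct, whatever the order of
   the loops, and the set of correct entries only grows. *)

theory Submission
  imports Defs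
begin

section \<open>Traces and Killing forms\<close>

text \<open>Several notions are given by choice or description: \<open>endo_trace\<close> by a
  chosen basis, \<open>sharp\<close> and \<open>level\<close> by \<open>THE\<close>, the string
  length by \<open>LEAST\<close>, the top level by \<open>Max\<close>. They are shown to denote what
  they should: traces through arbitrary frames, \<open>sharp\<close> through definiteness of the
  real form, \<open>level\<close> through independence of the base, the last two through finiteness
  of the root system, which itself comes from independence of the root vectors
  \<open>X \<alpha>\<close>. Compactness acts at three places: roots are imaginary on t, so that
  \<open>sharp\<close> exists in i t; conjugation then exchanges the root spaces of \<alpha> and -
  \<alpha>; and every root has positive square length. The obstacle in the calculus of constants is
  a pair of roots with sum 0, where \<open>c\<close> carries no information, so every identity keeps
  its sums away from 0. For root strings this rests on twice a root never being a root, which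
  follows from the string recursion itself. That recursion only determines squares; the assumed
  positivity selects the sign in (C5) and permits the division in (C7).\<close>

lemma basis_frame:
  fixes s :: "'f::field \<Rightarrow> 'v::ab_group_add \<Rightarrow> 'v"
  assumes vs: "vector_space s" and fin: "\<exists>B. finite B \<and> module.span s B = UNIV"
    and B: "\<not> module.dependent s B" "module.span s B = UNIV"
  shows "finite B" "Vector_Spaces.linear s (*) (\<lambda>v. module.representation s B v b)"
    "(\<Sum>b\<in>B. s (module.representation s B v b) b) = v"
proof -
  interpret vector_space s by (rule vs)
  obtain T where T: "finite T" "span T = UNIV" using fin by blast
  show finB: "finite B"
    using independent_span_bound[OF T(1) B(1)] T(2) by simp
  show "(\<Sum>b\<in>B. s (representation B v b) b) = v"
    by (rule sum_representation_eq) (simp_all add: B finB)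
  have "representation B (u + w) b = representation B u b + representation B w b" for u w
    by (subst representation_add) (simp_all add: B)
  moreover have "representation B (s r w) b = r * representation B w b" for r w
    by (subst representation_scale) (simp_all add: B)
  moreover have "vector_space ((*) :: 'f \<Rightarrow> 'f \<Rightarrow> 'f)"
    by unfold_locales (simp_all add: algebra_simps)
  ultimately show "Vector_Spaces.linear s (*) (\<lambda>v. representation B v b)"
    by (simp only: Vector_Spaces.linear_iff vs simp_thms)
qed

lemma spanning_independent_exists:
  assumes "vector_space s"
  shows "\<exists>B. \<not> module.dependent s B \<and> module.span s B = UNIV"
proof -
  interpret vector_space s by (rule assms)
  obtain B where "independent B" "UNIV \<subseteq> span B"
    by (rule basis_exists[of UNIV])
  then show ?thesis by blast
qed

text \<open>Write each \<open>e i\<close> in the chosen basis, swap the two sums, and reassemble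
  \<open>f b\<close> from the frame. All that is asked of \<open>e\<close> is that it reproduces
  every vector, so a real basis can serve for the complexification without a separate independence
  proof.\<close>

lemma endo_trace_frame:
  fixes s :: "'f::field \<Rightarrow> 'v::ab_group_add \<Rightarrow> 'v" and e :: "'i \<Rightarrow> 'v"
  assumes vs: "vector_space s" and fin: "\<exists>B. finite B \<and> module.span s B = UNIV"
    and f: "Vector_Spaces.linear s s f"
    and I: "finite I" and \<phi>: "\<And>i. i \<in> I \<Longrightarrow> Vector_Spaces.linear s (*) (\<phi> i)"
    and e: "\<And>v. (\<Sum>i\<in>I. s (\<phi> i v) (e i)) = v"
  shows "endo_trace s f = (\<Sum>i\<in>I. \<phi> i (f (e i)))"
proof -
  interpret vector_space s by (rule vs)
  define B where "B = (SOME B. \<not> dependent B \<and> span B = UNIV)"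
  have "\<not> dependent B \<and> span B = UNIV"
    unfolding B_def by (rule someI_ex[OF spanning_independent_exists[OF vs]])
  then have B: "\<not> dependent B" "span B = UNIV" by auto
  note rep = basis_frame(3)[OF vs fin B] and repl = basis_frame(2)[OF vs fin B]
  have "(\<Sum>i\<in>I. \<phi> i (f (e i))) = (\<Sum>i\<in>I. \<Sum>b\<in>B. representation B (e i) b * \<phi> i (f b))"
  proof (rule sum.cong[OF refl])
    fix i assume i: "i \<in> I"
    interpret p: Vector_Spaces.linear s "(*)" "\<phi> i" by (rule \<phi>[OF i])
    interpret f: Vector_Spaces.linear s s f by (rule f)
    have "\<phi> i (f (e i)) = \<phi> i (f (\<Sum>b\<in>B. s (representation B (e i) b) b))"
      by (simp only: rep)
    also have "\<dots> = (\<Sum>b\<in>B. representation B (e i) b * \<phi> i (f b))"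
      by (simp add: f.sum p.sum f.scale p.scale)
    finally show "\<phi> i (f (e i)) = \<dots>" .
  qed
  also have "\<dots> = (\<Sum>b\<in>B. \<Sum>i\<in>I. representation B (e i) b * \<phi> i (f b))"
    by (rule sum.swap)
  also have "\<dots> = (\<Sum>b\<in>B. representation B (f b) b)"
  proof (rule sum.cong[OF refl])
    fix b
    interpret r: Vector_Spaces.linear s "(*)" "\<lambda>v. representation B v b" by (rule repl)
    have "representation B (f b) b = representation B (\<Sum>i\<in>I. s (\<phi> i (f b)) (e i)) b"
      by (simp only: e)
    then show "(\<Sum>i\<in>I. representation B (e i) b * \<phi> i (f b)) = representation B (f b) b"
      by (simp only: r.sum r.scale mult.commute)
  qed
  finally show ?thesis
    unfolding endo_trace_def B_def[symmetric] Let_def by simp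
qed

lemma frame_exists:
  fixes s :: "'f::field \<Rightarrow> 'v::ab_group_add \<Rightarrow> 'v"
  assumes vs: "vector_space s" and fin: "\<exists>B. finite B \<and> module.span s B = UNIV"
  obtains B :: "'v set" and \<phi> where "finite B" "\<And>b. Vector_Spaces.linear s (*) (\<phi> b)"
    "\<And>v. (\<Sum>b\<in>B. s (\<phi> b v) b) = v"
proof -
  obtain B where B: "\<not> module.dependent s B" "module.span s B = UNIV"
    using spanning_independent_exists[OF vs] by auto
  show thesis
    by (rule that[OF basis_frame(1)[OF vs fin B] basis_frame(2)[OF vs fin B] basis_frame(3)[OF vs fin B]])
qed

section \<open>Lie algebras over a field and invariance of the Killing form\<close>

locale lie_alg = vector_space scale
  for scale :: "'f::field \<Rightarrow> 'v::ab_group_add \<Rightarrow> 'v" +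
  fixes brk :: "'v \<Rightarrow> 'v \<Rightarrow> 'v"
  assumes brk_add_right: "brk x (y + z) = brk x y + brk x z"
    and brk_scale_right: "brk x (scale a y) = scale a (brk x y)"
    and brk_anti: "brk y x = - brk x y"
    and brk_jacobi: "brk x (brk y z) + brk y (brk z x) + brk z (brk x y) = 0"
    and fin_dim: "\<exists>B. finite B \<and> span B = UNIV"
begin

lemma brk_add_left: "brk (x + y) z = brk x z + brk y z"
  by (simp only: brk_anti[of _ z] brk_add_right minus_add_distrib)

lemma brk_scale_left: "brk (scale a x) z = scale a (brk x z)"
  by (simp only: brk_anti[of _ z] brk_scale_right scale_minus_right)

lemma linear_brk: "Vector_Spaces.linear scale scale (brk x)"
  by unfold_locales (auto simp: brk_add_right brk_scale_right)

lemma linear_brk_brk: "Vector_Spaces.linear scale scale (\<lambda>z. brk x (brk y z))"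
  by unfold_locales (auto simp: brk_add_right brk_scale_right)

lemma brk_0_right: "brk x 0 = 0"
  using brk_add_right[of x 0 0] by simp

lemma brk_minus_right: "brk x (- y) = - brk x y"
  using brk_add_right[of x y "- y"] by (simp add: brk_0_right eq_neg_iff_add_eq_0 add.commute)

lemma brk_0_left: "brk 0 x = 0"
  using brk_add_left[of 0 0 x] by simp

lemma brk_minus_left: "brk (- x) y = - brk x y"
  using brk_add_left[of x "- x" y] by (simp add: brk_0_left eq_neg_iff_add_eq_0 add.commute)

lemma brk_diff_right: "brk x (y - z) = brk x y - brk x z"
  using brk_add_right[of x y "- z"] by (simp add: brk_minus_right)

lemma brk_diff_left: "brk (x - y) z = brk x z - brk y z"
  using brk_add_left[of x "- y" z] by (simp add: brk_minus_left)

text \<open>The Jacobi identity in the form that the adjoint map is a representation: a bracket in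
  the first slot becomes a commutator, both under the trace and on root vectors.\<close>

lemma brk_brk: "brk (brk x y) z = brk x (brk y z) - brk y (brk x z)"
proof -
  have "brk (brk x y) z = - brk z (brk x y)" by (rule brk_anti)
  also have "\<dots> = brk x (brk y z) + brk y (brk z x)"
    using brk_jacobi[of x y z] by (simp add: add_eq_0_iff2)
  also have "brk z x = - brk x z" by (rule brk_anti)
  finally show ?thesis by (simp add: brk_minus_right)
qed

lemma endo_trace_comm:
  assumes f: "Vector_Spaces.linear scale scale f" and g: "Vector_Spaces.linear scale scale g"
  shows "endo_trace scale (\<lambda>z. f (g z)) = endo_trace scale (\<lambda>z. g (f z))"
proof -
  obtain B \<phi> where B: "finite B" "\<And>b. Vector_Spaces.linear scale (*) (\<phi> b)"
    "\<And>v. (\<Sum>b\<in>B. scale (\<phi> b v) b) = v"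
    using frame_exists[OF vector_space_axioms fin_dim] by blast
  \<comment> \<open>Inserting the frame identity between the two maps gives the matrix product
    formula, whose double sum is symmetric in the two maps up to a swap of the indices.\<close>
  have *: "endo_trace scale (\<lambda>z. f (g z)) = (\<Sum>b\<in>B. \<Sum>d\<in>B. \<phi> d (g b) * \<phi> b (f d))"
    if f: "Vector_Spaces.linear scale scale f" and g: "Vector_Spaces.linear scale scale g" for f g
  proof -
    have "endo_trace scale (\<lambda>z. f (g z)) = (\<Sum>b\<in>B. \<phi> b (f (g b)))"
      by (rule endo_trace_frame[OF vector_space_axioms fin_dim
            Vector_Spaces.linear_compose[OF g f, unfolded o_def] B])
    also have "\<dots> = (\<Sum>b\<in>B. \<Sum>d\<in>B. \<phi> d (g b) * \<phi> b (f d))"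
    proof (rule sum.cong[OF refl])
      fix b
      interpret p: Vector_Spaces.linear scale "(*)" "\<phi> b" by (rule B)
      interpret f: Vector_Spaces.linear scale scale f by (rule f)
      have "\<phi> b (f (g b)) = \<phi> b (f (\<Sum>d\<in>B. scale (\<phi> d (g b)) d))"
        by (simp only: B(3))
      then show "\<phi> b (f (g b)) = (\<Sum>d\<in>B. \<phi> d (g b) * \<phi> b (f d))"
        by (simp add: f.sum p.sum f.scale p.scale)
    qed
    finally show ?thesis .
  qed
  show ?thesis
    using sum.swap[of "\<lambda>b d. \<phi> d (g b) * \<phi> b (f d)" B B]
    by (simp only: *[OF f g] *[OF g f] mult.commute[of "\<phi> _ (f _)"])
qed

lemma endo_trace_add:
  assumes f: "Vector_Spaces.linear scale scale f" and g: "Vector_Spaces.linear scale scale g"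
  shows "endo_trace scale (\<lambda>z. f z + g z) = endo_trace scale f + endo_trace scale g"
proof -
  obtain B \<phi> where B: "finite B" "\<And>b. Vector_Spaces.linear scale (*) (\<phi> b)"
    "\<And>v. (\<Sum>b\<in>B. scale (\<phi> b v) b) = v"
    using frame_exists[OF vector_space_axioms fin_dim] by blast
  have p: "\<phi> b (x + y) = \<phi> b x + \<phi> b y" for b x y
    using B(2)[of b] by (simp only: Vector_Spaces.linear_iff)
  have fg: "Vector_Spaces.linear scale scale (\<lambda>z. f z + g z)"
    using f g by (intro vector_space_pair.linear_compose_add) (auto simp: Vector_Spaces.linear_iff vector_space_pair_def)
  note tr = endo_trace_frame[OF vector_space_axioms fin_dim _ B]
  show ?thesis
    by (simp only: tr[OF f] tr[OF g] tr[OF fg] p sum.distrib)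
qed

lemma endo_trace_scale:
  assumes f: "Vector_Spaces.linear scale scale f"
  shows "endo_trace scale (\<lambda>z. scale a (f z)) = a * endo_trace scale f"
proof -
  obtain B \<phi> where B: "finite B" "\<And>b. Vector_Spaces.linear scale (*) (\<phi> b)"
    "\<And>v. (\<Sum>b\<in>B. scale (\<phi> b v) b) = v"
    using frame_exists[OF vector_space_axioms fin_dim] by blast
  have p: "\<phi> b (scale a x) = a * \<phi> b x" for b x
    using B(2)[of b] by (simp only: Vector_Spaces.linear_iff)
  have af: "Vector_Spaces.linear scale scale (\<lambda>z. scale a (f z))"
    using f by (auto simp: Vector_Spaces.linear_iff scale_right_distrib scale_left_commute)
  note tr = endo_trace_frame[OF vector_space_axioms fin_dim _ B]
  show ?thesis
    by (simp only: tr[OF f] tr[OF af] p sum_distrib_left)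
qed

abbreviation "\<kappa> \<equiv> killing scale brk"

lemma killing_sym: "\<kappa> x y = \<kappa> y x"
  unfolding killing_def by (rule endo_trace_comm[OF linear_brk linear_brk])

lemma killing_add_left: "\<kappa> (x + y) z = \<kappa> x z + \<kappa> y z"
  unfolding killing_def brk_add_left by (rule endo_trace_add[OF linear_brk_brk linear_brk_brk])

lemma killing_scale_left: "\<kappa> (scale a x) z = a * \<kappa> x z"
  unfolding killing_def brk_scale_left by (rule endo_trace_scale[OF linear_brk_brk])

lemma killing_add_right: "\<kappa> z (x + y) = \<kappa> z x + \<kappa> z y"
  by (metis killing_sym killing_add_left)

lemma killing_scale_right: "\<kappa> z (scale a x) = a * \<kappa> z x"
  by (metis killing_sym killing_scale_left)

lemma killing_0_left: "\<kappa> 0 z = 0"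
  using killing_scale_left[of 0 0 z] by simp

lemma killing_0_right: "\<kappa> z 0 = 0"
  by (metis killing_sym killing_0_left)

lemma killing_minus_left: "\<kappa> (- x) z = - \<kappa> x z"
  using killing_scale_left[of "-1" x z] by simp

text \<open>By \<open>brk_brk\<close> both sides are differences of traces of triple products of
  adjoint maps. They share the term \<open>?t x y z\<close>, and the remaining ones agree by a
  cyclic shift.\<close>

lemma killing_invariant: "\<kappa> (brk x y) z = \<kappa> x (brk y z)"
proof -
  let ?T = "endo_trace scale"
  let ?t = "\<lambda>u v w. ?T (\<lambda>p. brk u (brk v (brk w p)))"
  have lin: "Vector_Spaces.linear scale scale (\<lambda>p. brk u (brk v (brk w p)))" for u v w
    by unfold_locales (auto simp: brk_add_right brk_scale_right)
  have nlin: "Vector_Spaces.linear scale scale (\<lambda>p. scale (-1) (brk u (brk v (brk w p))))" for u v w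
    by unfold_locales (auto simp: brk_add_right brk_scale_right algebra_simps)
  have dif: "?T (\<lambda>p. brk u (brk v (brk w p)) - brk u' (brk v' (brk w' p))) = ?t u v w - ?t u' v' w'"
    for u v w u' v' w'
    using endo_trace_add[OF lin[of u v w] nlin[of u' v' w']] endo_trace_scale[OF lin, of "-1" u' v' w']
    by simp
  have "\<kappa> (brk x y) z = ?t x y z - ?t y x z"
    unfolding killing_def brk_brk by (rule dif)
  moreover have "\<kappa> x (brk y z) = ?t x y z - ?t x z y"
    unfolding killing_def brk_brk
    using dif[of x y z x z y] by (simp add: brk_diff_right)
  moreover have "?t y x z = ?t x z y"
    by (rule endo_trace_comm[OF linear_brk linear_brk_brk])
  ultimately show ?thesis by simp
qed

text \<open>Invariance moves the outer bracket of each Jacobi term onto \<open>d\<close>, so every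
  term pairs two brackets. On root vectors each such pairing becomes a product of two
  constants.\<close>

lemma killing_jacobi:
  "\<kappa> (brk a b) (brk c d) + \<kappa> (brk b c) (brk a d) + \<kappa> (brk c a) (brk b d) = 0"
proof -
  have *: "\<kappa> (brk x y) d = - \<kappa> y (brk x d)" for x y
    by (metis killing_invariant brk_anti killing_minus_left)
  have "0 = \<kappa> (brk a (brk b c) + brk b (brk c a) + brk c (brk a b)) d"
    by (simp add: brk_jacobi killing_0_left)
  also have "\<dots> = - (\<kappa> (brk a b) (brk c d) + \<kappa> (brk b c) (brk a d) + \<kappa> (brk c a) (brk b d))"
    by (simp add: killing_add_left *)
  finally show ?thesis by (metis neg_0_equal_iff_equal)
qed

end

lemma real_lie_algebra_lie_alg:
  fixes br :: "'g::real_vector \<Rightarrow> 'g \<Rightarrow> 'g"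
  assumes "real_lie_algebra br"
  shows "lie_alg (*\<^sub>R) br"
proof -
  have b: "bilinear br" and alt: "\<And>x. br x x = 0"
    and jac: "\<And>x y z. br x (br y z) + br y (br z x) + br z (br x y) = 0"
    and fin: "\<exists>B::'g set. finite B \<and> span B = UNIV"
    using assms by (auto simp: real_lie_algebra_def)
  have "br y x = - br x y" for x y
  proof -
    have "br y x + br x y = br (x + y) (x + y)"
      by (simp only: bilinear_ladd[OF b] bilinear_radd[OF b]) (simp add: alt)
    also have "\<dots> = 0" by (rule alt)
    finally show ?thesis by (simp only: eq_neg_iff_add_eq_0)
  qed note anti = this
  show ?thesis
  proof (intro lie_alg.intro lie_alg_axioms.intro)
    show "vector_space ((*\<^sub>R) :: real \<Rightarrow> 'g \<Rightarrow> 'g)"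
      by (rule real_vector.vector_space_axioms)
    show "br x (y + z) = br x y + br x z" for x y z
      by (rule bilinear_radd[OF b])
    show "br x (a *\<^sub>R y) = a *\<^sub>R br x y" for x a y
      by (rule bilinear_rmul[OF b])
    show "\<exists>B::'g set. finite B \<and> module.span (*\<^sub>R) B = UNIV"
      using fin by (simp only: span_raw_def)
  qed (rule anti jac)+
qed

section \<open>Complexification of a compact Lie algebra\<close>

lemma complexification_spans:
  fixes B :: "'g::real_vector set"
  assumes "finite B" "\<And>v. (\<Sum>b\<in>B. \<phi> b v *\<^sub>R b) = v"
  shows "(\<Sum>b\<in>B. cscale (Complex (\<phi> b (fst V)) (\<phi> b (snd V))) (b, 0)) = V"
  using assms by (simp add: cscale_def prod_eq_iff fst_sum snd_sum)

locale compact_lie =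
  fixes br :: "'g::real_vector \<Rightarrow> 'g \<Rightarrow> 'g"
  assumes compact: "compact_lie_algebra br"
begin

sublocale R: lie_alg "(*\<^sub>R)" br
  using compact real_lie_algebra_lie_alg by (auto simp: compact_lie_algebra_def)

lemma real_frame:
  obtains B :: "'g set" and \<phi> where "finite B" "\<And>b. Vector_Spaces.linear (*\<^sub>R) (*) (\<phi> b)"
    "\<And>v. (\<Sum>b\<in>B. \<phi> b v *\<^sub>R b) = v"
  using frame_exists[OF R.lie_alg_axioms[THEN lie_alg.axioms(1)] R.fin_dim] by blast

sublocale C: lie_alg cscale "cbr br"
proof -
  interpret V: vector_space "cscale :: complex \<Rightarrow> 'g cplx \<Rightarrow> 'g cplx" by (rule vector_space_cscale)
  note simps = cbr_def cscale_def R.brk_add_left R.brk_add_right R.brk_scale_left R.brk_scale_right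
    R.brk_diff_left R.brk_diff_right
  have jac: "cbr br x (cbr br y z) + cbr br y (cbr br z x) + cbr br z (cbr br x y) = 0" for x y z
  proof -
    \<comment> \<open>By trilinearity each component of the complex Jacobi sum is a signed sum of
      four real ones; the minus signs come from squares of i.\<close>
    let ?J = "\<lambda>u v w. br u (br v w) + br v (br w u) + br w (br u v)"
    have "fst (cbr br x (cbr br y z) + cbr br y (cbr br z x) + cbr br z (cbr br x y)) =
      ?J (fst x) (fst y) (fst z) - ?J (fst x) (snd y) (snd z)
       - ?J (snd x) (fst y) (snd z) - ?J (snd x) (snd y) (fst z)"
      by (simp add: simps algebra_simps)
    moreover have "snd (cbr br x (cbr br y z) + cbr br y (cbr br z x) + cbr br z (cbr br x y)) =
      ?J (fst x) (fst y) (snd z) + ?J (fst x) (snd y) (fst z)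
       + ?J (snd x) (fst y) (fst z) - ?J (snd x) (snd y) (snd z)"
      by (simp add: simps algebra_simps)
    ultimately show ?thesis
      by (simp add: R.brk_jacobi prod_eq_iff)
  qed
  have anti: "cbr br y x = - cbr br x y" for x y
    using R.brk_anti[of "fst x" "fst y"] R.brk_anti[of "snd x" "snd y"]
      R.brk_anti[of "fst x" "snd y"] R.brk_anti[of "snd x" "fst y"]
    by (simp add: cbr_def)
  obtain B :: "'g set" and \<phi> where B: "finite B" "\<And>b. Vector_Spaces.linear (*\<^sub>R) (*) (\<phi> b)"
    "\<And>v. (\<Sum>b\<in>B. \<phi> b v *\<^sub>R b) = v"
    using real_frame by blast
  have "V \<in> V.span ((\<lambda>b. (b, 0)) ` B)" for V :: "'g cplx"
    by (subst complexification_spans[OF B(1,3), symmetric])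
      (intro V.span_sum V.span_scale V.span_base, auto)
  then have "V.span ((\<lambda>b. (b, 0)) ` B) = (UNIV :: 'g cplx set)" by blast
  then have fin: "\<exists>B :: 'g cplx set. finite B \<and> V.span B = UNIV"
    using B(1) by blast
  show "lie_alg cscale (cbr br)"
  proof (intro lie_alg.intro lie_alg_axioms.intro)
    show "vector_space (cscale :: complex \<Rightarrow> 'g cplx \<Rightarrow> 'g cplx)" by (rule vector_space_cscale)
    show "cbr br x (y + z) = cbr br x y + cbr br x z" for x y z
      by (simp add: simps)
    show "cbr br x (cscale a y) = cscale a (cbr br x y)" for x a y
      by (simp add: simps algebra_simps)
  qed (rule anti jac fin)+
qed

text \<open>The complexified adjoint maps have the same matrix in the frame \<open>(b, 0)\<close> as
  the real ones in \<open>b\<close>. This carries definiteness of the real form over to the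
  complexification.\<close>

lemma ckilling_of_real:
  "ckilling br (x, 0) (y, 0) = of_real (killing (*\<^sub>R) br x y)"
proof -
  obtain B :: "'g set" and \<phi> where B: "finite B" "\<And>b. Vector_Spaces.linear (*\<^sub>R) (*) (\<phi> b)"
    "\<And>v. (\<Sum>b\<in>B. \<phi> b v *\<^sub>R b) = v"
    using real_frame by blast
  have p: "\<phi> b (u + v) = \<phi> b u + \<phi> b v" "\<phi> b (r *\<^sub>R u) = r * \<phi> b u" for b u v r
    using B(2)[of b] by (simp_all only: Vector_Spaces.linear_iff)
  have p2: "\<phi> b (u - v) = \<phi> b u - \<phi> b v" "\<phi> b 0 = 0" for b u v
    using p(1)[of b "u - v" v] p(2)[of b 0 0] by simp_all
  have lin: "Vector_Spaces.linear cscale (*) (\<lambda>V. Complex (\<phi> b (fst V)) (\<phi> b (snd V)))" for b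
    by (intro Vector_Spaces.linear.intro module_hom.intro module_hom_axioms.intro)
     (unfold_locales, auto simp: p p2 cscale_def complex_eq_iff algebra_simps)
  have "ckilling br (x, 0) (y, 0) =
    (\<Sum>b\<in>B. Complex (\<phi> b (fst (cbr br (x, 0) (cbr br (y, 0) (b, 0)))))
       (\<phi> b (snd (cbr br (x, 0) (cbr br (y, 0) (b, 0))))))"
    unfolding ckilling_def killing_def
    by (rule endo_trace_frame[OF vector_space_cscale C.fin_dim C.linear_brk_brk B(1) lin
          complexification_spans[OF B(1,3)]])
  also have "\<dots> = (\<Sum>b\<in>B. of_real (\<phi> b (br x (br y b))))"
    by (simp add: cbr_def R.brk_0_left R.brk_0_right p2 complex_of_real_def)
  also have "\<dots> = of_real (killing (*\<^sub>R) br x y)"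
    unfolding killing_def
    by (subst endo_trace_frame[OF R.lie_alg_axioms[THEN lie_alg.axioms(1)] R.fin_dim R.linear_brk_brk B]) simp
  finally show ?thesis .
qed

end

section \<open>Roots of a compact Lie algebra\<close>

locale compact_lie_torus = compact_lie br
  for br :: "'g::real_vector \<Rightarrow> 'g \<Rightarrow> 'g" +
  fixes t :: "'g set"
  assumes subspace_t: "subspace t"
begin

abbreviation (input) "K \<equiv> ckilling br"
abbreviation (input) "k \<equiv> killing (*\<^sub>R) br"
abbreviation "\<Delta> \<equiv> roots br t"

lemmas K_sym = C.killing_sym[folded ckilling_def]
lemmas K_invariant = C.killing_invariant[folded ckilling_def]
lemmas K_scale_left = C.killing_scale_left[folded ckilling_def]
lemmas K_scale_right = C.killing_scale_right[folded ckilling_def]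
lemmas K_add_right = C.killing_add_right[folded ckilling_def]
lemmas K_0_left = C.killing_0_left[folded ckilling_def]
lemmas K_jacobi = C.killing_jacobi[folded ckilling_def]

lemma k_neg: "x \<noteq> 0 \<Longrightarrow> k x x < 0"
  using compact by (simp add: compact_lie_algebra_def)

lemma imaginary_eq: "(0, a) = cscale \<i> (a, 0)"
  by (simp add: cscale_def)

lemma split_cplx: "(x, y) = (x, 0) + cscale \<i> (y, 0)"
  by (simp add: cscale_def)

lemma K_imaginary_left: "K (0, a) (x, 0) = \<i> * of_real (k a x)"
  unfolding imaginary_eq K_scale_left ckilling_of_real ..

lemma K_imaginary: "K (0, a) (0, b) = - of_real (k a b)"
  unfolding imaginary_eq K_scale_left K_scale_right ckilling_of_real by simp

text \<open>Gram-Schmidt: the new vector \<open>b\<close> is corrected by its projection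
  \<open>u\<close> onto the old span, which makes \<open>w\<close> orthogonal to \<open>B\<close>.
  Definiteness gives \<open>k w w \<noteq> 0\<close>, so a multiple of \<open>w\<close> adjusts the
  value at \<open>b\<close> and leaves those on \<open>B\<close> alone.\<close>

lemma represent_functional_basis:
  assumes "finite B" "independent B"
  shows "\<exists>a\<in>span B. \<forall>b\<in>B. k a b = f b"
  using assms
proof (induction B arbitrary: f rule: finite_induct)
  case empty
  then show ?case by (auto intro: span_zero)
next
  case (insert b B)
  then have ind: "independent B" and bB: "b \<notin> span B"
    by (auto simp: independent_insert)
  obtain u where u: "u \<in> span B" "\<forall>x\<in>B. k u x = k b x"
    using insert.IH[OF ind] by blast
  obtain a where a: "a \<in> span B" "\<forall>x\<in>B. k a x = f x"
    using insert.IH[OF ind] by blast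
  define w where "w = b - u"
  have w0: "w \<noteq> 0" using bB u by (auto simp: w_def)
  have k_diff: "k (x - y) z = k x z - k y z" for x y z
    using R.killing_add_left[of x "- y" z] by (simp add: R.killing_minus_left)
  have wB: "k w x = 0" if "x \<in> B" for x
    using u that by (simp add: w_def k_diff)
  have "k w x = 0" if "x \<in> span B" for x
    using that
  proof (induction rule: span_induct_alt)
    case base
    then show ?case by (rule R.killing_0_right)
  next
    case (step c x y)
    then show ?case by (simp add: R.killing_add_right R.killing_scale_right wB)
  qed
  then have "k w u = 0" using u by blast
  then have wb: "k w b = k w w"
    using R.killing_add_right[of w w u] by (simp add: w_def)
  have ww: "k w w \<noteq> 0" using k_neg[OF w0] by simp
  define s where "s = (f b - k a b) / k w w"
  have "a + s *\<^sub>R w \<in> span (insert b B)"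
    using a u by (auto simp: w_def intro!: span_add span_scale span_diff intro: span_base
        span_mono[THEN subsetD, of B])
  moreover have "k (a + s *\<^sub>R w) x = f x" if "x \<in> insert b B" for x
    using that a ww
    by (auto simp: R.killing_add_left R.killing_scale_left wB wb s_def)
  ultimately show ?case by blast
qed

lemma represent_functional:
  assumes add: "\<And>x y. x \<in> t \<Longrightarrow> y \<in> t \<Longrightarrow> f (x + y) = f x + f y"
    and scale: "\<And>r x. x \<in> t \<Longrightarrow> f (r *\<^sub>R x) = r * f x"
  obtains a where "a \<in> t" "\<And>x. x \<in> t \<Longrightarrow> k a x = f x"
proof -
  obtain B where B: "B \<subseteq> t" "independent B" "t \<subseteq> span B"
    by (rule basis_exists[of t])
  obtain T :: "'g set" where T: "finite T" "span T = UNIV"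
    using compact by (auto simp: compact_lie_algebra_def real_lie_algebra_def)
  have "finite B"
    using independent_span_bound[OF T(1) B(2)] T(2) by simp
  then obtain a where a: "a \<in> span B" "\<forall>b\<in>B. k a b = f b"
    using represent_functional_basis[OF _ B(2)] by blast
  have sB: "span B = t"
    by (rule span_subspace[OF B(1,3) subspace_t])
  have "x \<in> t \<and> k a x = f x" if "x \<in> span B" for x
    using that
  proof (induction rule: span_induct_alt)
    case base
    then show ?case
      using scale[OF subspace_0[OF subspace_t], of 0] subspace_0[OF subspace_t]
      by (simp add: R.killing_0_right)
  next
    case (step c x y)
    then have "x \<in> t" "y \<in> t" "c *\<^sub>R x \<in> t"
      using B(1) subspace_t by (auto simp: subspace_scale)
    then show ?case
      using a(2) step subspace_t
      by (simp add: R.killing_add_right R.killing_scale_right add scale subspace_add)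
  qed
  then show thesis using that a sB by blast
qed

section \<open>Roots on the Cartan subalgebra and their dual vectors\<close>

lemma weight_add: "\<alpha> \<in> weights t \<Longrightarrow> H \<in> t \<times> t \<Longrightarrow> H' \<in> t \<times> t \<Longrightarrow> \<alpha> (H + H') = \<alpha> H + \<alpha> H'"
  unfolding weights_def by blast

lemma weight_scale: "\<alpha> \<in> weights t \<Longrightarrow> H \<in> t \<times> t \<Longrightarrow> \<alpha> (cscale z H) = z * \<alpha> H"
  unfolding weights_def by blast

lemma weight_split:
  assumes "\<alpha> \<in> weights t" "x \<in> t" "y \<in> t"
  shows "\<alpha> (x, y) = \<alpha> (x, 0) + \<i> * \<alpha> (y, 0)"
proof -
  have 0: "0 \<in> t" using subspace_t by (rule subspace_0)
  then have "\<alpha> (x, y) = \<alpha> (x, 0) + \<alpha> (0, y)"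
    using weight_add[OF assms(1), of "(x, 0)" "(0, y)"] assms by simp
  also have "\<alpha> (0, y) = \<i> * \<alpha> (y, 0)"
    unfolding imaginary_eq using assms 0 by (intro weight_scale) auto
  finally show ?thesis .
qed

lemma root_weight: "\<alpha> \<in> \<Delta> \<Longrightarrow> \<alpha> \<in> weights t"
  by (simp add: roots_def)

lemma zero_not_root: "0 \<notin> \<Delta>"
  by (simp add: roots_def)

lemma root_vector_exists:
  assumes "\<alpha> \<in> \<Delta>"
  obtains Y where "Y \<in> root_space br t \<alpha>" "Y \<noteq> 0"
proof -
  have "0 \<in> root_space br t \<alpha>"
    by (simp add: root_space_def C.brk_0_right)
  then show thesis using assms that by (auto simp: roots_def)
qed

text \<open>Because \<open>ad H\<close> is skew for the definite form \<open>k\<close>, its eigenvalues are purely imaginary.\<close>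

lemma root_imaginary:
  assumes "\<alpha> \<in> \<Delta>" "H \<in> t"
  shows "Re (\<alpha> (H, 0)) = 0"
proof -
  obtain Y where Y: "Y \<in> root_space br t \<alpha>" "Y \<noteq> 0"
    using root_vector_exists assms by blast
  obtain u v where uv: "Y = (u, v)" by fastforce
  define a where "a = Re (\<alpha> (H, 0))"
  define b where "b = Im (\<alpha> (H, 0))"
  have "cbr br (H, 0) Y = cscale (\<alpha> (H, 0)) Y"
    using Y assms subspace_0[OF subspace_t] by (auto simp: root_space_def)
  then have e: "br H u = a *\<^sub>R u - b *\<^sub>R v" "br H v = a *\<^sub>R v + b *\<^sub>R u"
    by (auto simp: uv cbr_def cscale_def a_def b_def R.brk_0_left)
  have skew: "k (br H x) x = 0" for x
  proof -
    have "k (br H x) x = k x (br H x)" by (rule R.killing_sym)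
    also have "\<dots> = k (br x H) x" by (rule R.killing_invariant[symmetric])
    also have "\<dots> = - k (br H x) x"
      by (subst R.brk_anti) (rule R.killing_minus_left)
    finally show ?thesis by simp
  qed
  have k_diff: "k (x - y) z = k x z - k y z" for x y z
    using R.killing_add_left[of x "- y" z] by (simp add: R.killing_minus_left)
  \<comment> \<open>For Y = u + i v the mixed terms carrying \<open>b\<close> cancel by symmetry of
    \<open>k\<close>; only \<open>a\<close> survives, multiplied by a strictly negative
    number.\<close>
  have "k (br H u) u + k (br H v) v = a * (k u u + k v v)"
    unfolding e by (simp add: k_diff R.killing_add_left R.killing_scale_left R.killing_sym[of v u] algebra_simps)
  then have "a * (k u u + k v v) = 0" by (simp add: skew)
  moreover have "k u u + k v v < 0"
    using Y(2) k_neg[of u] k_neg[of v] R.killing_0_left by (cases "u = 0"; cases "v = 0") (auto simp: uv zero_prod_def)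
  ultimately show ?thesis by (simp add: a_def)
qed

text \<open>On t the root is i times a real functional, represented by some \<open>a\<close> through
  \<open>k\<close>, and \<open>(0, a)\<close> stands for i a. Two solutions differ by a vector of i
  t orthogonal to t, hence by 0 because the form is definite.\<close>

lemma sharp_properties:
  assumes \<alpha>: "\<alpha> \<in> \<Delta>"
  shows "sharp br t \<alpha> \<in> {0} \<times> t \<and> (\<forall>H\<in>t. K (sharp br t \<alpha>) (H, 0) = \<alpha> (H, 0))"
proof -
  have 0: "0 \<in> t" using subspace_t by (rule subspace_0)
  define f where "f = (\<lambda>x. Im (\<alpha> (x, 0)))"
  have f: "\<alpha> (x, 0) = \<i> * of_real (f x)" if "x \<in> t" for x
    using root_imaginary[OF \<alpha> that] by (simp add: f_def complex_eq_iff)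
  obtain a where a: "a \<in> t" "\<And>x. x \<in> t \<Longrightarrow> k a x = f x"
  proof (rule represent_functional)
    show "f (x + y) = f x + f y" if "x \<in> t" "y \<in> t" for x y
      using weight_add[OF root_weight[OF \<alpha>], of "(x, 0)" "(y, 0)"] that 0 by (simp add: f_def)
    show "f (r *\<^sub>R x) = r * f x" if "x \<in> t" for r x
      using weight_scale[OF root_weight[OF \<alpha>], of "(x, 0)" "of_real r"] that 0
      by (simp add: f_def cscale_def)
  qed blast
  show ?thesis
    unfolding sharp_def
  proof (rule theI[of _ "(0, a)"])
    show "(0, a) \<in> {0} \<times> t \<and> (\<forall>H\<in>t. K (0, a) (H, 0) = \<alpha> (H, 0))"
      using a f by (simp add: K_imaginary_left)
  next
    fix A assume A: "A \<in> {0} \<times> t \<and> (\<forall>H\<in>t. K A (H, 0) = \<alpha> (H, 0))"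
    then obtain b where b: "A = (0, b)" "b \<in> t" by auto
    have "k b x = k a x" if "x \<in> t" for x
    proof -
      have "\<i> * of_real (k b x) = \<i> * complex_of_real (k a x)"
        using A that a f by (simp add: b flip: K_imaginary_left)
      then show ?thesis by simp
    qed
    then have "k (b - a) (b - a) = 0"
      using R.killing_add_left[of b "- a" "b - a"] a(1) b(2) subspace_t
      by (simp add: R.killing_minus_left subspace_diff)
    then show "A = (0, a)"
      using k_neg[of "b - a"] b by fastforce
  qed
qed

lemma sharp_in: "\<alpha> \<in> \<Delta> \<Longrightarrow> sharp br t \<alpha> \<in> t \<times> t"
  using sharp_properties[of \<alpha>] subspace_0[OF subspace_t] by auto

lemma K_sharp:
  assumes "\<alpha> \<in> \<Delta>" "H \<in> t \<times> t"
  shows "K (sharp br t \<alpha>) H = \<alpha> H"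
proof -
  obtain x y where H: "H = (x, y)" "x \<in> t" "y \<in> t" using assms by auto
  have "K (sharp br t \<alpha>) H = K (sharp br t \<alpha>) (x, 0) + \<i> * K (sharp br t \<alpha>) (y, 0)"
    unfolding H(1) by (subst split_cplx) (simp only: K_add_right K_scale_right)
  also have "\<dots> = \<alpha> H"
    using sharp_properties[OF assms(1)] H weight_split[OF root_weight[OF assms(1)]] by simp
  finally show ?thesis .
qed

lemma root_outside: "\<alpha> \<in> \<Delta> \<Longrightarrow> H \<notin> t \<times> t \<Longrightarrow> \<alpha> H = 0"
  unfolding roots_def weights_def by blast

lemma root_nonzero:
  assumes "\<alpha> \<in> \<Delta>"
  obtains H where "H \<in> t \<times> t" "\<alpha> H \<noteq> 0"
proof -
  have "\<alpha> \<noteq> 0"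
    using assms zero_not_root by auto
  then show thesis using that root_outside[OF assms] by (metis ext zero_fun_apply)
qed

lemma sharp_nonzero: "\<alpha> \<in> \<Delta> \<Longrightarrow> sharp br t \<alpha> \<noteq> 0"
  using root_nonzero[of \<alpha>] K_sharp[of \<alpha>] K_0_left by metis

text \<open>Roots take imaginary values on t; this form of the fact lets the weight of a conjugated
  root vector be read off.\<close>

lemma weight_conjugate:
  assumes \<alpha>: "\<alpha> \<in> \<Delta>" and H: "H \<in> t \<times> t"
  shows "cnj (\<alpha> (conjugate H)) = - \<alpha> H"
proof -
  obtain x y where xy: "H = (x, y)" "x \<in> t" "y \<in> t" using H by auto
  have "- y \<in> t" using subspace_t xy by (simp add: subspace_neg)
  moreover have "\<alpha> (- y, 0) = - \<alpha> (y, 0)"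
    using weight_scale[OF root_weight[OF \<alpha>], of "(y, 0)" "-1"] xy subspace_0[OF subspace_t]
    by (simp add: cscale_def)
  ultimately show ?thesis
    using root_imaginary[OF \<alpha>] xy weight_split[OF root_weight[OF \<alpha>]]
    by (simp add: conjugate_def complex_eq_iff)
qed

lemma uminus_root:
  assumes \<alpha>: "\<alpha> \<in> \<Delta>"
  shows "- \<alpha> \<in> \<Delta>"
proof -
  obtain Y where Y: "Y \<in> root_space br t \<alpha>" "Y \<noteq> 0"
    using root_vector_exists \<alpha> by blast
  have "conjugate Y \<in> root_space br t (- \<alpha>)"
    unfolding root_space_def
  proof (intro CollectI ballI)
    fix H assume H: "H \<in> t \<times> t"
    have "conjugate H \<in> t \<times> t"
      using H subspace_t by (auto simp: conjugate_def subspace_neg)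
    with CollectD[OF Y(1)[unfolded root_space_def]]
    have "cbr br (conjugate H) Y = cscale (\<alpha> (conjugate H)) Y"
      by (rule bspec)
    moreover have "cbr br H (conjugate Y) = conjugate (cbr br (conjugate H) Y)"
      by (simp add: cbr_def conjugate_def R.brk_minus_left R.brk_minus_right)
    ultimately have "cbr br H (conjugate Y) = cscale (cnj (\<alpha> (conjugate H))) (conjugate Y)"
      by (simp add: conjugate_def cscale_def)
    then show "cbr br H (conjugate Y) = cscale ((- \<alpha>) H) (conjugate Y)"
      by (simp add: weight_conjugate[OF \<alpha> H])
  qed
  moreover have "conjugate Y \<noteq> 0"
    using Y(2) by (auto simp: conjugate_def prod_eq_iff)
  moreover have "- \<alpha> \<in> weights t"
    using root_weight[OF \<alpha>] by (auto simp: weights_def)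
  moreover have "- \<alpha> \<noteq> 0"
    using \<alpha> zero_not_root by auto
  ultimately show ?thesis by (auto simp: roots_def)
qed

lemma uminus_root_iff: "- \<alpha> \<in> \<Delta> \<longleftrightarrow> \<alpha> \<in> \<Delta>"
  using uminus_root[of \<alpha>] uminus_root[of "- \<alpha>"] by auto

abbreviation inner_r ("\<langle>_, _\<rangle>") where "\<langle>\<alpha>, \<beta>\<rangle> \<equiv> root_inner br t \<alpha> \<beta>"

text \<open>Taking \<open>Re\<close> in \<open>root_inner\<close> loses nothing on i t. Linearity of
  the product in its first slot thereby becomes pointwise linearity of roots.\<close>

lemma root_at_sharp:
  assumes "\<alpha> \<in> \<Delta>" "\<beta> \<in> \<Delta>"
  shows "\<alpha> (sharp br t \<beta>) = of_real \<langle>\<alpha>, \<beta>\<rangle>"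
proof -
  have "\<alpha> (sharp br t \<beta>) = K (sharp br t \<alpha>) (sharp br t \<beta>)"
    using K_sharp[OF assms(1) sharp_in[OF assms(2)]] by simp
  moreover obtain a b where "sharp br t \<alpha> = (0, a)" "sharp br t \<beta> = (0, b)"
    using sharp_properties assms by blast
  ultimately show ?thesis
    by (simp add: root_inner_def K_imaginary)
qed

lemma root_inner_pos:
  assumes "\<alpha> \<in> \<Delta>"
  shows "\<langle>\<alpha>, \<alpha>\<rangle> > 0"
proof -
  obtain a where "sharp br t \<alpha> = (0, a)"
    using sharp_properties assms by blast
  then show ?thesis
    using sharp_nonzero[OF assms] k_neg[of a] by (auto simp: root_inner_def K_imaginary zero_prod_def)
qed

end

section \<open>Chevalley bases\<close>

locale chevalley = compact_lie_torus br t
  for br :: "'g::real_vector \<Rightarrow> 'g \<Rightarrow> 'g" and t +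
  fixes X :: "'g weight \<Rightarrow> 'g cplx" and c :: "'g weight \<Rightarrow> 'g weight \<Rightarrow> real"
  assumes chevalley: "chevalley_basis br t X c"
begin

abbreviation cb ("[_, _]") where "[x, y] \<equiv> cbr br x y"

lemma root_vector: "\<alpha> \<in> \<Delta> \<Longrightarrow> H \<in> t \<times> t \<Longrightarrow> [H, X \<alpha>] = cscale (\<alpha> H) (X \<alpha>)"
  using chevalley unfolding chevalley_basis_def Let_def root_space_def by blast

lemma X_opposite: "\<alpha> \<in> \<Delta> \<Longrightarrow> [X \<alpha>, X (- \<alpha>)] = sharp br t \<alpha>"
  using chevalley by (simp add: chevalley_basis_def Let_def)

lemma X_bracket:
  "\<alpha> \<in> \<Delta> \<Longrightarrow> \<beta> \<in> \<Delta> \<Longrightarrow> \<alpha> + \<beta> \<in> \<Delta> \<Longrightarrow> [X \<alpha>, X \<beta>] = cscale (of_real (c \<alpha> \<beta>)) (X (\<alpha> + \<beta>))"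
  using chevalley by (simp add: chevalley_basis_def Let_def)

lemma X_bracket_zero:
  "\<alpha> \<in> \<Delta> \<Longrightarrow> \<beta> \<in> \<Delta> \<Longrightarrow> \<alpha> + \<beta> \<notin> \<Delta> \<Longrightarrow> \<alpha> + \<beta> \<noteq> 0 \<Longrightarrow> [X \<alpha>, X \<beta>] = 0"
  using chevalley by (simp add: chevalley_basis_def Let_def)

lemma c_zero:
  "\<alpha> \<in> \<Delta> \<Longrightarrow> \<beta> \<in> \<Delta> \<Longrightarrow> \<alpha> + \<beta> \<notin> \<Delta> \<Longrightarrow> \<alpha> + \<beta> \<noteq> 0 \<Longrightarrow> c \<alpha> \<beta> = 0"
  using chevalley by (simp add: chevalley_basis_def Let_def)

text \<open>\<open>chevalley_basis\<close> states this for sums in \<open>\<Delta>\<close>; for the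
  other nonzero sums both constants are 0, as - \<alpha> - \<beta> is no root either.\<close>

lemma c_uminus:
  assumes "\<alpha> \<in> \<Delta>" "\<beta> \<in> \<Delta>" "\<alpha> + \<beta> \<noteq> 0"
  shows "c (- \<alpha>) (- \<beta>) = - c \<alpha> \<beta>"
proof (cases "\<alpha> + \<beta> \<in> \<Delta>")
  case True
  then show ?thesis
    using chevalley assms by (simp add: chevalley_basis_def Let_def)
next
  case False
  have "- \<alpha> + - \<beta> = - (\<alpha> + \<beta>)" by simp
  then have "- \<alpha> + - \<beta> \<notin> \<Delta>" "- \<alpha> + - \<beta> \<noteq> 0"
    using False assms uminus_root_iff by (metis, metis neg_equal_0_iff_equal)
  then show ?thesis
    using False assms c_zero uminus_root by simp
qed

lemma X_nonzero: "\<alpha> \<in> \<Delta> \<Longrightarrow> X \<alpha> \<noteq> 0"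
  using X_opposite[of \<alpha>] sharp_nonzero[of \<alpha>] C.brk_0_left by metis

text \<open>Pair \<open>[X \<alpha>, X (- \<alpha>)]\<close> with an \<open>H\<close> at which
  \<alpha> does not vanish: by \<open>K_sharp\<close> the value is \<open>\<alpha> H\<close>, and by
  invariance it is \<open>\<alpha> H\<close> times the number sought.\<close>

lemma K_X_opposite:
  assumes "\<alpha> \<in> \<Delta>"
  shows "K (X \<alpha>) (X (- \<alpha>)) = 1"
proof -
  obtain H where H: "H \<in> t \<times> t" "\<alpha> H \<noteq> 0"
    using root_nonzero[OF assms] by blast
  have "[X (- \<alpha>), H] = cscale (\<alpha> H) (X (- \<alpha>))"
    using C.brk_anti[of "X (- \<alpha>)" H] root_vector[OF uminus_root[OF assms] H(1)] by simp
  then have "\<alpha> H = \<alpha> H * K (X \<alpha>) (X (- \<alpha>))"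
    using K_sharp[OF assms H(1)] K_invariant[of "X \<alpha>" "X (- \<alpha>)" H]
    by (simp add: X_opposite[OF assms] K_scale_right)
  then show ?thesis using H(2) by simp
qed

section \<open>Symmetries of the Chevalley constants\<close>

lemma c_anti:
  assumes "\<alpha> \<in> \<Delta>" "\<beta> \<in> \<Delta>" "\<alpha> + \<beta> \<noteq> 0"
  shows "c \<beta> \<alpha> = - c \<alpha> \<beta>"
proof (cases "\<alpha> + \<beta> \<in> \<Delta>")
  case True
  have "cscale (of_real (c \<beta> \<alpha>)) (X (\<alpha> + \<beta>)) = cscale (of_real (- c \<alpha> \<beta>)) (X (\<alpha> + \<beta>))"
    using C.brk_anti[of "X \<beta>" "X \<alpha>"] X_bracket[of \<alpha> \<beta>] X_bracket[of \<beta> \<alpha>] assms True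
    by (simp add: add.commute)
  then have "complex_of_real (c \<beta> \<alpha>) = of_real (- c \<alpha> \<beta>)"
    using X_nonzero[OF True] by (simp only: C.scale_cancel_right simp_thms)
  then show ?thesis by (simp only: of_real_eq_iff)
next
  case False
  then show ?thesis using assms c_zero by (simp add: add.commute)
qed

lemma c_cyclic:
  assumes "\<alpha> \<in> \<Delta>" "\<beta> \<in> \<Delta>" "\<gamma> \<in> \<Delta>" "\<alpha> + \<beta> + \<gamma> = 0"
  shows "c \<alpha> \<beta> = c \<beta> \<gamma>"
proof -
  have s: "\<alpha> + \<beta> = - \<gamma>" "\<beta> + \<gamma> = - \<alpha>"
    using assms(4) by (simp_all add: eq_neg_iff_add_eq_0 add.commute add.left_commute)
  have "K [X \<alpha>, X \<beta>] (X \<gamma>) = of_real (c \<alpha> \<beta>)"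
    using X_bracket[of \<alpha> \<beta>] K_X_opposite[OF assms(3)] uminus_root assms
    by (simp add: s K_scale_left K_sym[of "X (- \<gamma>)"])
  moreover have "K (X \<alpha>) [X \<beta>, X \<gamma>] = of_real (c \<beta> \<gamma>)"
    using X_bracket[of \<beta> \<gamma>] K_X_opposite[OF assms(1)] uminus_root assms
    by (simp add: s K_scale_right)
  ultimately show ?thesis
    using K_invariant[of "X \<alpha>" "X \<beta>" "X \<gamma>"] by simp
qed

text \<open>The two brackets lie along opposite roots, where \<open>K_X_opposite\<close> gives 1; if
  the sums are not roots, both sides vanish.\<close>

lemma K_brackets:
  assumes "\<alpha> \<in> \<Delta>" "\<beta> \<in> \<Delta>" "\<gamma> \<in> \<Delta>" "\<delta> \<in> \<Delta>" "\<alpha> + \<beta> + \<gamma> + \<delta> = 0" "\<alpha> + \<beta> \<noteq> 0"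
  shows "K [X \<alpha>, X \<beta>] [X \<gamma>, X \<delta>] = of_real (c \<alpha> \<beta> * c \<gamma> \<delta>)"
proof (cases "\<alpha> + \<beta> \<in> \<Delta>")
  case True
  have s: "\<gamma> + \<delta> = - (\<alpha> + \<beta>)"
    using assms(5) by (metis add.assoc add.commute add_eq_0_iff)
  have "\<gamma> + \<delta> \<in> \<Delta>"
    unfolding s using True by (rule uminus_root)
  then show ?thesis
    using X_bracket[OF assms(1,2) True] X_bracket[OF assms(3,4)] K_X_opposite[OF True]
    unfolding s by (simp only: K_scale_left K_scale_right of_real_mult mult_1_left mult_1_right mult.commute)
next
  case False
  then show ?thesis using assms X_bracket_zero c_zero K_0_left by simp
qed

text \<open>The three inequalities keep every bracket out of the complexified Cartan subalgebra,
  where \<open>c\<close> is unconstrained. As the four roots sum to 0, they cover the complementary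
  pairs as well.\<close>

lemma c_jacobi:
  assumes "\<alpha> \<in> \<Delta>" "\<beta> \<in> \<Delta>" "\<gamma> \<in> \<Delta>" "\<delta> \<in> \<Delta>" "\<alpha> + \<beta> + \<gamma> + \<delta> = 0"
    and "\<alpha> + \<beta> \<noteq> 0" "\<beta> + \<gamma> \<noteq> 0" "\<gamma> + \<alpha> \<noteq> 0"
  shows "c \<alpha> \<beta> * c \<gamma> \<delta> + c \<beta> \<gamma> * c \<alpha> \<delta> + c \<gamma> \<alpha> * c \<beta> \<delta> = 0"
proof -
  have "\<beta> + \<gamma> + \<alpha> + \<delta> = 0" "\<gamma> + \<alpha> + \<beta> + \<delta> = 0"
    using assms(5) by (simp_all add: ac_simps)
  then have "complex_of_real (c \<alpha> \<beta> * c \<gamma> \<delta> + c \<beta> \<gamma> * c \<alpha> \<delta> + c \<gamma> \<alpha> * c \<beta> \<delta>) = 0"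
    using K_jacobi[of "X \<alpha>" "X \<beta>" "X \<gamma>" "X \<delta>"] assms
    by (simp only: K_brackets of_real_add simp_thms not_False_eq_True)
  then show ?thesis by (simp only: of_real_eq_0_iff)
qed

section \<open>Root strings\<close>

lemma c_shift:
  assumes "\<zeta> \<in> \<Delta>" "\<beta> \<in> \<Delta>" "\<zeta> + \<beta> \<in> \<Delta>"
  shows "c (- \<zeta>) (\<zeta> + \<beta>) = c \<zeta> \<beta>"
proof -
  have ne: "\<zeta> + \<beta> \<noteq> 0" using assms zero_not_root by metis
  \<comment> \<open>Two cyclic moves, sign reversal and antisymmetry. Raising and lowering along
    \<zeta> thus have the same coefficient, so going up and back produces a square.\<close>
  have "c (- \<zeta>) (\<zeta> + \<beta>) = c (\<zeta> + \<beta>) (- \<beta>)"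
    using assms uminus_root by (intro c_cyclic) auto
  also have "\<dots> = c (- \<beta>) (- \<zeta>)"
    using assms uminus_root by (intro c_cyclic) auto
  also have "\<dots> = - c \<beta> \<zeta>"
    using assms ne by (intro c_uminus) (auto simp: add.commute)
  also have "\<dots> = c \<zeta> \<beta>"
    using assms ne by (simp add: c_anti)
  finally show ?thesis .
qed

text \<open>Outside \<open>\<Delta>\<close> the constant is unconstrained. The value 0 there matches
  the bracket that vanishes below the lower end of a string, so the recursion holds at that end
  too.\<close>

definition csq :: "'g weight \<Rightarrow> 'g weight \<Rightarrow> real" where
  "csq \<zeta> \<beta> = (if \<beta> \<in> \<Delta> then (c \<zeta> \<beta>)\<^sup>2 else 0)"

text \<open>Evaluating \<open>ad (\<zeta>\<^sup>\<sharp>) = [ad X\<^sub>\<zeta>, ad X\<^sub>-\<^sub>\<zeta>]\<close> on \<open>X\<^sub>\<beta>\<close> gives a recursion along the \<open>\<zeta>\<close>-string through \<open>\<beta>\<close>.\<close>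

lemma csq_recursion:
  assumes "\<zeta> \<in> \<Delta>" "\<beta> \<in> \<Delta>" "\<beta> - \<zeta> \<noteq> 0" "\<beta> + \<zeta> \<noteq> 0"
  shows "csq \<zeta> (\<beta> - \<zeta>) - csq \<zeta> \<beta> = \<langle>\<beta>, \<zeta>\<rangle>"
proof -
  have up: "[X (- \<zeta>), [X \<zeta>, X \<beta>]] = cscale (of_real (csq \<zeta> \<beta>)) (X \<beta>)"
  proof (cases "\<zeta> + \<beta> \<in> \<Delta>")
    case True
    have "[X (- \<zeta>), X (\<zeta> + \<beta>)] = cscale (of_real (c \<zeta> \<beta>)) (X \<beta>)"
      using X_bracket[of "- \<zeta>" "\<zeta> + \<beta>"] c_shift[of \<zeta> \<beta>] assms True uminus_root by simp
    then show ?thesis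
      using X_bracket[of \<zeta> \<beta>] assms True
      by (simp add: csq_def C.brk_scale_right power2_eq_square)
  next
    case False
    then show ?thesis
      using X_bracket_zero[of \<zeta> \<beta>] c_zero[of \<zeta> \<beta>] assms
      by (simp add: csq_def C.brk_0_right add.commute)
  qed
  have down: "[X \<zeta>, [X (- \<zeta>), X \<beta>]] = cscale (of_real (csq \<zeta> (\<beta> - \<zeta>))) (X \<beta>)"
  proof (cases "\<beta> - \<zeta> \<in> \<Delta>")
    case True
    have "[X (- \<zeta>), X \<beta>] = cscale (of_real (c (- \<zeta>) \<beta>)) (X (\<beta> - \<zeta>))"
      using X_bracket[of "- \<zeta>" \<beta>] assms True uminus_root by simp
    moreover have "[X \<zeta>, X (\<beta> - \<zeta>)] = cscale (of_real (c \<zeta> (\<beta> - \<zeta>))) (X \<beta>)"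
      using X_bracket[of \<zeta> "\<beta> - \<zeta>"] assms True by simp
    moreover have "c (- \<zeta>) \<beta> = c \<zeta> (\<beta> - \<zeta>)"
      using c_shift[of \<zeta> "\<beta> - \<zeta>"] assms True by simp
    ultimately show ?thesis
      using True by (simp add: csq_def C.brk_scale_right power2_eq_square)
  next
    case False
    then show ?thesis
      using X_bracket_zero[of "- \<zeta>" \<beta>] assms uminus_root
      by (simp add: csq_def C.brk_0_right)
  qed
  have "[[X \<zeta>, X (- \<zeta>)], X \<beta>] = cscale (of_real \<langle>\<beta>, \<zeta>\<rangle>) (X \<beta>)"
    using root_vector[of \<beta> "sharp br t \<zeta>"] assms
    by (simp add: X_opposite sharp_in root_at_sharp)
  then have "cscale (of_real \<langle>\<beta>, \<zeta>\<rangle>) (X \<beta>) = cscale (of_real (csq \<zeta> (\<beta> - \<zeta>) - csq \<zeta> \<beta>)) (X \<beta>)"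
    by (simp add: C.brk_brk up down C.scale_left_diff_distrib)
  then have "complex_of_real \<langle>\<beta>, \<zeta>\<rangle> = of_real (csq \<zeta> (\<beta> - \<zeta>) - csq \<zeta> \<beta>)"
    using X_nonzero[OF assms(2)] by (simp only: C.scale_cancel_right simp_thms)
  then show ?thesis by (simp only: of_real_eq_iff)
qed

text \<open>Both products are read as values of roots at the dual vector of \<zeta>, where
  differences are taken pointwise.\<close>

lemma inner_add_multiple:
  assumes "\<beta> \<in> \<Delta>" "\<zeta> \<in> \<Delta>" "\<beta> - rscale r \<zeta> \<in> \<Delta>"
  shows "\<langle>\<beta> - rscale r \<zeta>, \<zeta>\<rangle> = \<langle>\<beta>, \<zeta>\<rangle> - r * \<langle>\<zeta>, \<zeta>\<rangle>"
proof -
  have "complex_of_real \<langle>\<beta> - rscale r \<zeta>, \<zeta>\<rangle> = of_real (\<langle>\<beta>, \<zeta>\<rangle> - r * \<langle>\<zeta>, \<zeta>\<rangle>)"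
    using assms by (simp add: rscale_def flip: root_at_sharp)
  then show ?thesis by (simp only: of_real_eq_iff)
qed

lemma double_nonzero: "\<zeta> \<in> \<Delta> \<Longrightarrow> \<zeta> + \<zeta> \<noteq> 0"
proof
  assume z: "\<zeta> \<in> \<Delta>" "\<zeta> + \<zeta> = 0"
  then have "\<zeta> H + \<zeta> H = 0" for H by (metis plus_fun_apply zero_fun_apply)
  then have "\<zeta> H = 0" for H by (metis mult_2 mult_eq_0_iff zero_neq_numeral)
  then show False using root_nonzero[OF z(1)] by metis
qed

text \<open>Antisymmetry gives \<open>c \<zeta> \<zeta> = 0\<close>. If 2 \<zeta> were a root, the
  recursion at 2 \<zeta> would equate minus a square with twice the positive number
  \<open>\<langle>\<zeta>, \<zeta>\<rangle>\<close>.\<close>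

lemma double_not_root:
  assumes z: "\<zeta> \<in> \<Delta>"
  shows "\<zeta> + \<zeta> \<notin> \<Delta>"
proof
  assume d: "\<zeta> + \<zeta> \<in> \<Delta>"
  have "c \<zeta> \<zeta> = 0"
    using c_anti[OF z z double_nonzero[OF z]] by simp
  have "\<zeta> + \<zeta> + \<zeta> \<noteq> 0"
  proof
    assume "\<zeta> + \<zeta> + \<zeta> = 0"
    then have "\<zeta> H + \<zeta> H + \<zeta> H = 0" for H by (metis plus_fun_apply zero_fun_apply)
    then have "3 * \<zeta> H = 0" for H by (simp add: algebra_simps)
    then show False using root_nonzero[OF z] by (metis mult_eq_0_iff zero_neq_numeral)
  qed
  moreover have "\<zeta> \<noteq> 0" using z zero_not_root by auto
  ultimately have "csq \<zeta> \<zeta> - csq \<zeta> (\<zeta> + \<zeta>) = \<langle>\<zeta> + \<zeta>, \<zeta>\<rangle>"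
    using csq_recursion[OF z d] by simp
  moreover have "\<langle>\<zeta> + \<zeta>, \<zeta>\<rangle> = \<langle>\<zeta>, \<zeta>\<rangle> + \<langle>\<zeta>, \<zeta>\<rangle>"
  proof -
    have e: "\<zeta> + \<zeta> = \<zeta> - rscale (-1) \<zeta>" by (simp add: rscale_def fun_eq_iff)
    show ?thesis
      using inner_add_multiple[OF z z, of "-1"] d unfolding e by simp
  qed
  moreover have "csq \<zeta> \<zeta> = 0" using \<open>c \<zeta> \<zeta> = 0\<close> by (simp add: csq_def)
  moreover have "csq \<zeta> (\<zeta> + \<zeta>) \<ge> 0" by (simp add: csq_def)
  ultimately show False using root_inner_pos[OF z] by simp
qed

lemma root_vectors_independent:
  assumes "finite S" "S \<subseteq> \<Delta>" "(\<Sum>\<alpha>\<in>S. cscale (u \<alpha>) (X \<alpha>)) = 0"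
  shows "\<forall>\<alpha>\<in>S. u \<alpha> = 0"
  using assms
proof (induction S arbitrary: u rule: finite_induct)
  case (insert \<beta> S)
  have \<beta>: "\<beta> \<in> \<Delta>" and S: "S \<subseteq> \<Delta>" using insert.prems by auto
  have u: "u \<alpha> = 0" if \<alpha>: "\<alpha> \<in> S" for \<alpha>
  proof -
    have "\<alpha> \<noteq> \<beta>" using \<alpha> insert.hyps by auto
    then obtain H where H: "\<alpha> H \<noteq> \<beta> H" by (auto simp: fun_eq_iff)
    \<comment> \<open>Functionals are extended by 0, so two roots agree off
      \<open>t \<times> t\<close> and the separating \<open>H\<close> lies inside it.\<close>
    moreover have "\<alpha> H = 0" "\<beta> H = 0" if "H \<notin> t \<times> t"
      using that \<alpha> S \<beta> root_outside by blast+
    ultimately have Ht: "H \<in> t \<times> t" by metis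
    interpret ad: Vector_Spaces.linear cscale cscale "cbr br H" by (rule C.linear_brk)
    have "0 = [H, \<Sum>\<gamma>\<in>insert \<beta> S. cscale (u \<gamma>) (X \<gamma>)]"
      using insert.prems by (simp add: C.brk_0_right)
    also have "\<dots> = (\<Sum>\<gamma>\<in>insert \<beta> S. cscale (\<gamma> H * u \<gamma>) (X \<gamma>))"
      unfolding ad.sum ad.scale
      using root_vector[OF _ Ht] insert.prems(1) by (intro sum.cong) (auto simp: mult.commute)
    finally have 1: "(\<Sum>\<gamma>\<in>insert \<beta> S. cscale (\<gamma> H * u \<gamma>) (X \<gamma>)) = 0" by simp
    \<comment> \<open>Applying ad H - \<beta>(H) kills the term of \<beta> and multiplies that of
      \<alpha> by a nonzero factor, which leaves a relation over \<open>S\<close>.\<close>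
    have "(\<Sum>\<gamma>\<in>insert \<beta> S. cscale ((\<gamma> H - \<beta> H) * u \<gamma>) (X \<gamma>)) =
      (\<Sum>\<gamma>\<in>insert \<beta> S. cscale (\<gamma> H * u \<gamma>) (X \<gamma>)) - cscale (\<beta> H) (\<Sum>\<gamma>\<in>insert \<beta> S. cscale (u \<gamma>) (X \<gamma>))"
      unfolding C.scale_sum_right sum_subtractf[symmetric]
      by (intro sum.cong) (simp_all only: left_diff_distrib C.scale_left_diff_distrib C.scale_scale)
    also have "\<dots> = 0" using 1 insert.prems(2) by simp
    finally have "(\<Sum>\<gamma>\<in>S. cscale ((\<gamma> H - \<beta> H) * u \<gamma>) (X \<gamma>)) = 0"
      using insert.hyps by simp
    then have "(\<alpha> H - \<beta> H) * u \<alpha> = 0"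
      using insert.IH[OF S, of "\<lambda>\<gamma>. (\<gamma> H - \<beta> H) * u \<gamma>"] \<alpha> by blast
    then show ?thesis using H by simp
  qed
  then have "cscale (u \<beta>) (X \<beta>) = 0"
    using insert by simp
  then show ?case
    using u X_nonzero[OF \<beta>] by auto
qed auto

text \<open>The root vectors are independent in a finite-dimensional space. They are distinct as
  well, since two equal ones would give a relation with coefficients 1 and -1.\<close>

lemma finite_roots: "finite \<Delta>"
proof -
  have inj: "inj_on X \<Delta>"
  proof (rule inj_onI, rule ccontr)
    fix \<alpha> \<beta> assume ab: "\<alpha> \<in> \<Delta>" "\<beta> \<in> \<Delta>" "X \<alpha> = X \<beta>" "\<alpha> \<noteq> \<beta>"
    then have "\<forall>\<gamma>\<in>{\<alpha>, \<beta>}. (if \<gamma> = \<alpha> then 1 else - 1 :: complex) = 0"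
      by (intro root_vectors_independent) auto
    then show False by simp
  qed
  have "C.independent (X ` \<Delta>)"
    unfolding C.independent_explicit_finite_subsets
  proof (intro allI impI ballI)
    fix A u v assume A: "A \<subseteq> X ` \<Delta>" "finite A" "(\<Sum>v\<in>A. cscale (u v) v) = 0" and v: "v \<in> A"
    obtain S where S: "S \<subseteq> \<Delta>" "A = X ` S" using A(1) by (auto simp: subset_image_iff)
    have injS: "inj_on X S" using inj S by (auto intro: inj_on_subset)
    then have "finite S" using A S by (simp add: finite_image_iff)
    moreover have "(\<Sum>\<alpha>\<in>S. cscale (u (X \<alpha>)) (X \<alpha>)) = 0"
      using A(3) by (simp add: S sum.reindex[OF injS] o_def)
    ultimately show "u v = 0"
      using root_vectors_independent[of S "\<lambda>\<alpha>. u (X \<alpha>)"] S v by auto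
  qed
  moreover obtain T where "finite T" "C.span T = UNIV" using C.fin_dim by blast
  ultimately have "finite (X ` \<Delta>)"
    using C.independent_span_bound[of T "X ` \<Delta>"] by simp
  then show ?thesis using inj by (simp add: finite_image_iff)
qed

text \<open>The recursion excludes neighbours equal to 0. If the string reached 0 here, the element
  two places above would be 2 \<zeta>, and that element is a root; for \<open>j = 0\<close> it is
  \<zeta> + \<eta>.\<close>

lemma string_not_zero:
  assumes "\<zeta> \<in> \<Delta>" "\<eta> \<in> \<Delta>" "\<zeta> + \<eta> \<in> \<Delta>" "\<And>i. i \<le> j \<Longrightarrow> \<eta> - rscale (real i) \<zeta> \<in> \<Delta>"
  shows "\<eta> - rscale (real (Suc j)) \<zeta> \<noteq> 0"
proof
  assume 0: "\<eta> - rscale (real (Suc j)) \<zeta> = 0"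
  show False
  proof (cases j)
    case 0
    then have "\<eta> = \<zeta>" using \<open>\<eta> - rscale (real (Suc j)) \<zeta> = 0\<close> by (simp add: rscale_def fun_eq_iff)
    then show False using assms double_not_root by auto
  next
    case (Suc i)
    have "\<eta> - rscale (real i) \<zeta> = \<zeta> + \<zeta>"
      using 0 by (simp add: Suc rscale_def fun_eq_iff algebra_simps)
    then show False using assms(4)[of i] double_not_root[OF assms(1)] Suc by simp
  qed
qed

text \<open>Telescopes \<open>csq_recursion\<close> at \<eta>, \<eta> - \<zeta>, ..., \<eta> - j
  \<zeta>. The product with \<zeta> drops by \<open>\<langle>\<zeta>, \<zeta>\<rangle>\<close> at
  each step, whence the triangular number j (j + 1) / 2.\<close>

lemma csq_string:
  assumes z: "\<zeta> \<in> \<Delta>" and e: "\<eta> \<in> \<Delta>" "\<zeta> + \<eta> \<in> \<Delta>"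
    and "\<And>i. i \<le> j \<Longrightarrow> \<eta> - rscale (real i) \<zeta> \<in> \<Delta>"
  shows "(c \<zeta> \<eta>)\<^sup>2 = csq \<zeta> (\<eta> - rscale (real (Suc j)) \<zeta>)
    - real (Suc j) * \<langle>\<eta>, \<zeta>\<rangle> + real j * real (Suc j) / 2 * \<langle>\<zeta>, \<zeta>\<rangle>"
  using assms(4)
proof (induction j)
  case 0
  have r: "rscale (real (Suc 0)) \<zeta> = \<zeta>" by (simp add: rscale_def)
  have "\<eta> - \<zeta> \<noteq> 0"
    using string_not_zero[OF z e, of 0] 0 unfolding r by blast
  moreover have "\<eta> + \<zeta> \<noteq> 0" using e zero_not_root by (metis add.commute)
  ultimately have "csq \<zeta> (\<eta> - \<zeta>) - csq \<zeta> \<eta> = \<langle>\<eta>, \<zeta>\<rangle>"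
    by (rule csq_recursion[OF z e(1)])
  moreover have "csq \<zeta> \<eta> = (c \<zeta> \<eta>)\<^sup>2" using e by (simp add: csq_def)
  ultimately show ?case
    unfolding r by (simp only: of_nat_0 of_nat_Suc add_0_right mult_1_left mult_zero_left div_0)
next
  case (Suc j)
  let ?b = "\<eta> - rscale (real (Suc j)) \<zeta>"
  have b: "?b \<in> \<Delta>" by (rule Suc.prems) simp
  have down: "?b - \<zeta> = \<eta> - rscale (real (Suc (Suc j))) \<zeta>"
    by (simp add: rscale_def fun_eq_iff algebra_simps)
  have up: "?b + \<zeta> = \<eta> - rscale (real j) \<zeta>"
    by (simp add: rscale_def fun_eq_iff algebra_simps)
  have "?b - \<zeta> \<noteq> 0"
    unfolding down using string_not_zero[OF z e, of "Suc j"] Suc.prems by blast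
  moreover have "?b + \<zeta> \<noteq> 0"
    unfolding up using Suc.prems[of j] zero_not_root by (metis le_add2 plus_1_eq_Suc)
  ultimately have "csq \<zeta> (?b - \<zeta>) - csq \<zeta> ?b = \<langle>?b, \<zeta>\<rangle>"
    by (rule csq_recursion[OF z b])
  also have "\<dots> = \<langle>\<eta>, \<zeta>\<rangle> - real (Suc j) * \<langle>\<zeta>, \<zeta>\<rangle>"
    by (rule inner_add_multiple[OF e(1) z b])
  finally have "csq \<zeta> ?b = csq \<zeta> (\<eta> - rscale (real (Suc (Suc j))) \<zeta>) - \<langle>\<eta>, \<zeta>\<rangle> + real (Suc j) * \<langle>\<zeta>, \<zeta>\<rangle>"
    unfolding down by simp
  moreover have "(c \<zeta> \<eta>)\<^sup>2 = csq \<zeta> ?b - real (Suc j) * \<langle>\<eta>, \<zeta>\<rangle> + real j * real (Suc j) / 2 * \<langle>\<zeta>, \<zeta>\<rangle>"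
    by (rule Suc.IH) (rule Suc.prems, simp)
  ultimately have "(c \<zeta> \<eta>)\<^sup>2 = csq \<zeta> (\<eta> - rscale (real (Suc (Suc j))) \<zeta>) - \<langle>\<eta>, \<zeta>\<rangle>
      + real (Suc j) * \<langle>\<zeta>, \<zeta>\<rangle> - real (Suc j) * \<langle>\<eta>, \<zeta>\<rangle> + real j * real (Suc j) / 2 * \<langle>\<zeta>, \<zeta>\<rangle>"
    by (simp only:)
  moreover have "x - y + real (Suc j) * z - real (Suc j) * y + real j * real (Suc j) / 2 * z =
      x - real (Suc (Suc j)) * y + real (Suc j) * real (Suc (Suc j)) / 2 * z" for x y z :: real
    by (simp add: field_simps)
  ultimately show ?case by (simp only:)
qed

text \<open>The multiples of \<zeta> are distinct while \<open>\<Delta>\<close> is finite; this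
  gives the \<open>LEAST\<close> in (C5) its meaning.\<close>

lemma string_length_exists:
  assumes "\<zeta> \<in> \<Delta>"
  shows "\<exists>p::nat. \<eta> - rscale (real (p + 1)) \<zeta> \<notin> \<Delta>"
proof (rule ccontr)
  assume "\<not> ?thesis"
  then have "range (\<lambda>p::nat. \<eta> - rscale (real (p + 1)) \<zeta>) \<subseteq> \<Delta>" by auto
  then have "finite (range (\<lambda>p::nat. \<eta> - rscale (real (p + 1)) \<zeta>))"
    using finite_roots finite_subset by blast
  moreover obtain H where "\<zeta> H \<noteq> 0" using root_nonzero[OF assms] by blast
  then have "inj (\<lambda>p::nat. \<eta> - rscale (real (p + 1)) \<zeta>)"
    by (intro injI) (drule fun_cong[of _ _ H], simp add: rscale_def)
  ultimately show False using finite_imageD by blast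
qed

text \<open>One step below the last root \<eta> - p \<zeta> of the string, \<open>csq\<close> is 0.
  The telescoped sum is then (p + 1) (p / 2 |\<zeta>|^2 - \<langle>\<eta>, \<zeta>\<rangle>), which
  is q (1 + p) / 2 times |\<zeta>|^2. Only the square is determined; \<open>pos\<close> picks the
  sign.\<close>

lemma decomposition_constant:
  assumes z: "\<zeta> \<in> \<Delta>" and e: "\<eta> \<in> \<Delta>" "\<zeta> + \<eta> \<in> \<Delta>" and pos: "c \<zeta> \<eta> \<ge> 0"
  defines "p \<equiv> real (LEAST p::nat. \<eta> - rscale (real (p + 1)) \<zeta> \<notin> \<Delta>)"
  shows "sqrt ((p - 2 * \<langle>\<eta>, \<zeta>\<rangle> / \<langle>\<zeta>, \<zeta>\<rangle>) * (1 + p) / 2) * sqrt \<langle>\<zeta>, \<zeta>\<rangle> = c \<zeta> \<eta>"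
proof -
  define n where "n = (LEAST p::nat. \<eta> - rscale (real (p + 1)) \<zeta> \<notin> \<Delta>)"
  have n: "\<eta> - rscale (real (Suc n)) \<zeta> \<notin> \<Delta>"
    using LeastI_ex[OF string_length_exists[OF z, of \<eta>]] by (simp add: n_def)
  have "\<eta> - rscale (real i) \<zeta> \<in> \<Delta>" if "i \<le> n" for i
  proof (cases i)
    case 0
    then show ?thesis using e by (simp add: rscale_def zero_fun_def[symmetric])
  next
    case (Suc m)
    then have "m < n" using that by simp
    then show ?thesis using not_less_Least[of m] Suc by (auto simp: n_def)
  qed
  then have "(c \<zeta> \<eta>)\<^sup>2 = - real (Suc n) * \<langle>\<eta>, \<zeta>\<rangle> + real n * real (Suc n) / 2 * \<langle>\<zeta>, \<zeta>\<rangle>"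
    using csq_string[OF z e, of n] n by (simp add: csq_def algebra_simps)
  also have "\<dots> = (p - 2 * \<langle>\<eta>, \<zeta>\<rangle> / \<langle>\<zeta>, \<zeta>\<rangle>) * (1 + p) / 2 * \<langle>\<zeta>, \<zeta>\<rangle>"
    using root_inner_pos[OF z] unfolding p_def n_def[symmetric] by (simp add: field_simps)
  finally have "sqrt ((p - 2 * \<langle>\<eta>, \<zeta>\<rangle> / \<langle>\<zeta>, \<zeta>\<rangle>) * (1 + p) / 2) * sqrt \<langle>\<zeta>, \<zeta>\<rangle> = sqrt ((c \<zeta> \<eta>)\<^sup>2)"
    by (simp only: real_sqrt_mult)
  then show ?thesis using pos by simp
qed

end

section \<open>Levels and the algorithm\<close>

locale chevalley_base = chevalley br t X c
  for br :: "'g::real_vector \<Rightarrow> 'g \<Rightarrow> 'g" and t X c +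
  fixes \<Psi> :: "'g weight set"
  assumes base: "root_base \<Delta> \<Psi>"
begin

abbreviation "P \<equiv> positive_roots \<Delta> \<Psi>"
abbreviation "lev \<equiv> level \<Psi>"

lemma finite_base: "finite \<Psi>" and base_roots: "\<Psi> \<subseteq> \<Delta>"
  using base by (auto simp: root_base_def)

text \<open>Independence of the base over the reals; it makes the \<open>THE\<close> in
  \<open>level\<close> unambiguous.\<close>

lemma int_comb_unique:
  assumes "int_comb \<Psi> m = int_comb \<Psi> n" "\<alpha> \<in> \<Psi>"
  shows "m \<alpha> = n \<alpha>"
proof -
  interpret V: vector_space "rscale :: real \<Rightarrow> 'g weight \<Rightarrow> 'g weight" by (rule vector_space_rscale)
  have "V.independent \<Psi>" using base by (simp add: root_base_def)
  moreover have "(\<Sum>\<alpha>\<in>\<Psi>. rscale (of_int (m \<alpha>) - of_int (n \<alpha>)) \<alpha>) = 0"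
    using assms(1) by (simp add: V.scale_left_diff_distrib sum_subtractf int_comb_def)
  ultimately have "real_of_int (m \<alpha>) - of_int (n \<alpha>) = 0"
    by (rule V.independentD[OF _ finite_base subset_refl _ assms(2),
          where u = "\<lambda>\<alpha>. of_int (m \<alpha>) - of_int (n \<alpha>)"])
  then show ?thesis by simp
qed

lemma level_int_comb: "lev (int_comb \<Psi> m) = sum m \<Psi>"
proof -
  have *: "sum n \<Psi> = sum m \<Psi>" if "int_comb \<Psi> m = int_comb \<Psi> n" for n
    using int_comb_unique[OF that] by (intro sum.cong) auto
  show ?thesis
    unfolding level_def
  proof (rule the_equality)
    show "\<exists>n. int_comb \<Psi> m = int_comb \<Psi> n \<and> sum m \<Psi> = sum n \<Psi>" by blast
  qed (use * in blast)
qed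

lemma int_comb_add: "int_comb \<Psi> m + int_comb \<Psi> n = int_comb \<Psi> (\<lambda>\<alpha>. m \<alpha> + n \<alpha>)"
proof -
  interpret V: vector_space "rscale :: real \<Rightarrow> 'g weight \<Rightarrow> 'g weight" by (rule vector_space_rscale)
  show ?thesis by (simp add: int_comb_def V.scale_left_distrib sum.distrib)
qed

lemma int_comb_uminus: "- int_comb \<Psi> m = int_comb \<Psi> (\<lambda>\<alpha>. - m \<alpha>)"
proof -
  interpret V: vector_space "rscale :: real \<Rightarrow> 'g weight \<Rightarrow> 'g weight" by (rule vector_space_rscale)
  show ?thesis by (simp add: int_comb_def sum_negf)
qed

lemma int_comb_0: "int_comb \<Psi> (\<lambda>_. 0) = 0"
proof -
  interpret V: vector_space "rscale :: real \<Rightarrow> 'g weight \<Rightarrow> 'g weight" by (rule vector_space_rscale)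
  show ?thesis by (simp add: int_comb_def)
qed

lemma int_comb_single:
  assumes "\<alpha> \<in> \<Psi>"
  shows "int_comb \<Psi> (\<lambda>\<beta>. if \<beta> = \<alpha> then 1 else 0) = \<alpha>"
proof -
  interpret V: vector_space "rscale :: real \<Rightarrow> 'g weight \<Rightarrow> 'g weight" by (rule vector_space_rscale)
  have "int_comb \<Psi> (\<lambda>\<beta>. if \<beta> = \<alpha> then 1 else 0) = (\<Sum>\<beta>\<in>\<Psi>. if \<beta> = \<alpha> then \<beta> else 0)"
    unfolding int_comb_def by (intro sum.cong) auto
  then show ?thesis using assms finite_base by simp
qed

lemma positive_root: "\<alpha> \<in> P \<Longrightarrow> \<alpha> \<in> \<Delta>"
  by (simp add: positive_roots_def)

lemma positive_comb:
  assumes "\<alpha> \<in> P"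
  obtains m where "\<alpha> = int_comb \<Psi> m" "\<And>\<beta>. \<beta> \<in> \<Psi> \<Longrightarrow> m \<beta> \<ge> 0"
  using assms by (auto simp: positive_roots_def)

text \<open>Nonnegative integers with sum 0 all vanish, which would make the root 0. Because of this
  bound both summands of a positive root have strictly smaller level.\<close>

lemma level_positive:
  assumes "\<alpha> \<in> P"
  shows "lev \<alpha> \<ge> 1"
proof -
  obtain m where m: "\<alpha> = int_comb \<Psi> m" "\<And>\<beta>. \<beta> \<in> \<Psi> \<Longrightarrow> m \<beta> \<ge> 0"
    using positive_comb[OF assms] by blast
  have "sum m \<Psi> \<noteq> 0"
  proof
    assume "sum m \<Psi> = 0"
    then have "\<forall>\<beta>\<in>\<Psi>. m \<beta> = 0"
      using sum_nonneg_eq_0_iff[of \<Psi> m] finite_base m by blast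
    then have "\<alpha> = int_comb \<Psi> (\<lambda>_. 0)" by (simp add: m(1) int_comb_def)
    then have "\<alpha> = 0" by (simp only: int_comb_0)
    then show False using positive_root[OF assms] zero_not_root by simp
  qed
  moreover have "sum m \<Psi> \<ge> 0" using m by (intro sum_nonneg)
  ultimately show ?thesis by (simp add: m(1) level_int_comb)
qed

lemma level_add:
  assumes "\<alpha> \<in> P" "\<beta> \<in> P"
  shows "lev (\<alpha> + \<beta>) = lev \<alpha> + lev \<beta>"
proof -
  obtain m n where "\<alpha> = int_comb \<Psi> m" "\<beta> = int_comb \<Psi> n"
    using assms positive_comb by metis
  then show ?thesis by (simp add: int_comb_add level_int_comb sum.distrib)
qed

text \<open>Hence a positive root of level at least 2 is not simple and comes with a chosen
  decomposition.\<close>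

lemma level_simple: "\<alpha> \<in> \<Psi> \<Longrightarrow> lev \<alpha> = 1"
  using level_int_comb[of "\<lambda>\<beta>. if \<beta> = \<alpha> then 1 else 0"] finite_base
  by (simp add: int_comb_single)

text \<open>Keeps pairs of positive roots away from the unconstrained entries
  \<open>c \<alpha> (- \<alpha>)\<close>.\<close>

lemma sum_positive_nonzero:
  assumes "\<alpha> \<in> P" "\<beta> \<in> P"
  shows "\<alpha> + \<beta> \<noteq> 0"
proof
  assume "\<alpha> + \<beta> = 0"
  then have "lev (\<alpha> + \<beta>) = lev (int_comb \<Psi> (\<lambda>_. 0))" by (simp only: int_comb_0)
  then show False
    using level_add[OF assms] level_positive[OF assms(1)] level_positive[OF assms(2)]
    by (simp add: level_int_comb)
qed

lemma sum_positive_root: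
  assumes "\<alpha> \<in> P" "\<beta> \<in> P" "\<alpha> + \<beta> \<in> \<Delta>"
  shows "\<alpha> + \<beta> \<in> P"
proof -
  obtain m where m: "\<alpha> = int_comb \<Psi> m" "\<And>\<beta>. \<beta> \<in> \<Psi> \<Longrightarrow> m \<beta> \<ge> 0"
    using positive_comb[OF assms(1)] by blast
  obtain n where n: "\<beta> = int_comb \<Psi> n" "\<And>\<beta>. \<beta> \<in> \<Psi> \<Longrightarrow> n \<beta> \<ge> 0"
    using positive_comb[OF assms(2)] by blast
  have "\<alpha> + \<beta> = int_comb \<Psi> (\<lambda>\<alpha>. m \<alpha> + n \<alpha>)" by (simp only: m(1) n(1) int_comb_add)
  moreover have "\<forall>\<beta>\<in>\<Psi>. m \<beta> + n \<beta> \<ge> 0" using m n by fastforce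
  ultimately show ?thesis
    using assms(3) unfolding positive_roots_def by blast
qed

lemma root_positive_or_negative:
  assumes "\<alpha> \<in> \<Delta>"
  shows "\<alpha> \<in> P \<or> \<alpha> \<in> uminus ` P"
proof -
  obtain m where m: "\<alpha> = int_comb \<Psi> m" and "(\<forall>\<beta>\<in>\<Psi>. m \<beta> \<ge> 0) \<or> (\<forall>\<beta>\<in>\<Psi>. m \<beta> \<le> 0)"
    using base assms unfolding root_base_def by blast
  then consider "\<forall>\<beta>\<in>\<Psi>. m \<beta> \<ge> 0" | "\<forall>\<beta>\<in>\<Psi>. m \<beta> \<le> 0" by blast
  then show ?thesis
  proof cases
    case 1
    then show ?thesis using assms m unfolding positive_roots_def by blast
  next
    case 2
    have "- \<alpha> = int_comb \<Psi> (\<lambda>\<beta>. - m \<beta>)" by (simp only: m int_comb_uminus)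
    moreover have "\<forall>\<beta>\<in>\<Psi>. - m \<beta> \<ge> 0" using 2 by simp
    ultimately have "- \<alpha> \<in> P"
      using uminus_root[OF assms] unfolding positive_roots_def by blast
    then show ?thesis by (metis imageI minus_minus)
  qed
qed

lemma finite_positive: "finite P"
  using finite_roots by (rule finite_subset[rotated]) (auto simp: positive_roots_def)

text \<open>(C7) reads constants of positive pairs, while the Jacobi identity produces
  \<open>c \<beta> (- \<alpha>)\<close>. Since \<beta>, - \<alpha> and \<alpha> - \<beta> sum to 0,
  rotation, antisymmetry and, for a negative difference, sign reversal translate between the
  two.\<close>

lemma c_diff:
  assumes "\<alpha> \<in> P" "\<beta> \<in> P" "\<alpha> \<noteq> \<beta>"
  shows "\<alpha> - \<beta> \<in> P \<Longrightarrow> c \<beta> (\<alpha> - \<beta>) = - c \<beta> (- \<alpha>)"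
    and "\<alpha> - \<beta> \<in> P \<Longrightarrow> c (\<alpha> - \<beta>) \<beta> = c \<beta> (- \<alpha>)"
    and "\<alpha> - \<beta> \<in> uminus ` P \<Longrightarrow> c \<alpha> (\<beta> - \<alpha>) = - c \<beta> (- \<alpha>)"
    and "\<alpha> - \<beta> \<in> uminus ` P \<Longrightarrow> c (\<beta> - \<alpha>) \<alpha> = c \<beta> (- \<alpha>)"
    and "\<alpha> - \<beta> \<notin> P \<Longrightarrow> \<alpha> - \<beta> \<notin> uminus ` P \<Longrightarrow> c \<beta> (- \<alpha>) = 0"
proof -
  note r = positive_root[OF assms(1)] positive_root[OF assms(2)]
  note nr = r[THEN uminus_root]
  have ne: "\<alpha> \<noteq> 0" "\<beta> \<noteq> 0" "- \<alpha> + \<beta> \<noteq> 0"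
    using r zero_not_root assms(3) by auto
  have anti: "c (- \<alpha>) \<beta> = - c \<beta> (- \<alpha>)"
    using r nr ne by (intro c_anti) (auto simp: add.commute)
  show 1: "c \<beta> (\<alpha> - \<beta>) = - c \<beta> (- \<alpha>)" if "\<alpha> - \<beta> \<in> P"
  proof -
    have "c (- \<alpha>) \<beta> = c \<beta> (\<alpha> - \<beta>)"
      using r nr that positive_root by (intro c_cyclic) auto
    then show ?thesis using anti by simp
  qed
  show "c (\<alpha> - \<beta>) \<beta> = c \<beta> (- \<alpha>)" if "\<alpha> - \<beta> \<in> P"
    using c_anti[of \<beta> "\<alpha> - \<beta>"] 1[OF that] that positive_root r ne by simp
  show 3: "c \<alpha> (\<beta> - \<alpha>) = - c \<beta> (- \<alpha>)" if "\<alpha> - \<beta> \<in> uminus ` P"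
  proof -
    have p: "\<beta> - \<alpha> \<in> P" using that by (metis imageE minus_diff_eq minus_minus)
    then have d: "\<beta> - \<alpha> \<in> \<Delta>" "\<alpha> - \<beta> \<in> \<Delta>"
      using positive_root uminus_root[of "\<beta> - \<alpha>"] by auto
    have "c \<beta> (- \<alpha>) = c (- \<alpha>) (\<alpha> - \<beta>)"
      using r nr d by (intro c_cyclic) auto
    also have "\<dots> = c (- \<alpha>) (- (\<beta> - \<alpha>))" by simp
    also have "\<dots> = - c \<alpha> (\<beta> - \<alpha>)"
      using r d ne by (intro c_uminus) auto
    finally show ?thesis by simp
  qed
  show "c (\<beta> - \<alpha>) \<alpha> = c \<beta> (- \<alpha>)" if "\<alpha> - \<beta> \<in> uminus ` P"
  proof -
    have "\<beta> - \<alpha> \<in> P" using that by (metis imageE minus_diff_eq minus_minus)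
    then show ?thesis
      using c_anti[of \<alpha> "\<beta> - \<alpha>"] 3[OF that] positive_root r ne by simp
  qed
  show "c \<beta> (- \<alpha>) = 0" if "\<alpha> - \<beta> \<notin> P" "\<alpha> - \<beta> \<notin> uminus ` P"
  proof (rule c_zero)
    have "\<beta> + - \<alpha> = - (\<alpha> - \<beta>)" by simp
    then show "\<beta> + - \<alpha> \<notin> \<Delta>"
      using that root_positive_or_negative uminus_root_iff by metis
  qed (use r nr ne in \<open>auto simp: add.commute\<close>)
qed

section \<open>The loop invariant\<close>

definition correct :: "'g ctable \<Rightarrow> ('g weight \<times> 'g weight) set" where
  "correct T = {(\<alpha>, \<beta>). T \<alpha> \<beta> = c \<alpha> \<beta>}"

text \<open>The entries fixed once level \<open>l\<close> is finished. Those whose sum is no root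
  belong to every stage, as (C1) fills them.\<close>

definition settled :: "int \<Rightarrow> ('g weight \<times> 'g weight) set" where
  "settled l = {(\<alpha>, \<beta>) \<in> P \<times> P. \<alpha> + \<beta> \<notin> P \<or> lev (\<alpha> + \<beta>) \<le> l}"

lemma correct_set_entry:
  assumes "v = c \<alpha> \<beta>"
  shows "insert (\<alpha>, \<beta>) (correct T) \<subseteq> correct (set_entry \<alpha> \<beta> v T)"
  using assms by (auto simp: correct_def set_entry_def)

lemma settled_init: "settled 1 \<subseteq> correct (init_table P T)"
proof (rule subsetI, clarify)
  fix \<alpha> \<beta> assume "(\<alpha>, \<beta>) \<in> settled 1"
  then have ab: "\<alpha> \<in> P" "\<beta> \<in> P" and d: "\<alpha> + \<beta> \<notin> P \<or> lev (\<alpha> + \<beta>) \<le> 1"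
    by (auto simp: settled_def)
  \<comment> \<open>A sum of two positive roots has level at least 2, so stage 1 holds exactly the
    zeros of (C1).\<close>
  have "\<alpha> + \<beta> \<notin> P"
    using d level_add[OF ab] level_positive[OF ab(1)] level_positive[OF ab(2)] by auto
  then have "c \<alpha> \<beta> = 0"
    using ab positive_root sum_positive_root sum_positive_nonzero c_zero by blast
  then show "(\<alpha>, \<beta>) \<in> correct (init_table P T)"
    using ab \<open>\<alpha> + \<beta> \<notin> P\<close> by (simp add: correct_def init_table_def)
qed

text \<open>Two patterns suffice for (C7): the first covers \<open>c11\<close>, \<open>c12\<close>
  and \<open>c22\<close>, the second \<open>c21\<close>. In each branch the pair looked up has sum
  \<alpha> or \<beta>, hence level below \<open>l\<close>.\<close>

lemma table_diff:
  assumes "settled (l - 1) \<subseteq> correct T" "\<alpha> \<in> P" "\<beta> \<in> P" "\<alpha> \<noteq> \<beta>" "lev \<alpha> < l" "lev \<beta> < l"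
  shows "(if \<alpha> - \<beta> \<in> P then T \<beta> (\<alpha> - \<beta>)
      else if \<alpha> - \<beta> \<in> uminus ` P then T \<alpha> (\<beta> - \<alpha>) else 0) = - c \<beta> (- \<alpha>)"
    and "(if \<alpha> - \<beta> \<in> P then T (\<alpha> - \<beta>) \<beta>
      else if \<alpha> - \<beta> \<in> uminus ` P then T (\<beta> - \<alpha>) \<alpha> else 0) = c \<beta> (- \<alpha>)"
proof -
  have T: "T x y = c x y" if "x \<in> P" "y \<in> P" "x + y = z" "lev z < l" for x y z
    using assms(1) that by (auto simp: settled_def correct_def)
  have neg: "\<beta> - \<alpha> \<in> P" if "\<alpha> - \<beta> \<in> uminus ` P"
    using that by (metis imageE minus_diff_eq minus_minus)
  have "T \<beta> (\<alpha> - \<beta>) = c \<beta> (\<alpha> - \<beta>)" "T (\<alpha> - \<beta>) \<beta> = c (\<alpha> - \<beta>) \<beta>" if "\<alpha> - \<beta> \<in> P"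
    using that assms by (auto intro!: T[of _ _ \<alpha>])
  moreover have "T \<alpha> (\<beta> - \<alpha>) = c \<alpha> (\<beta> - \<alpha>)" "T (\<beta> - \<alpha>) \<alpha> = c (\<beta> - \<alpha>) \<alpha>" if "\<alpha> - \<beta> \<in> uminus ` P"
    using neg[OF that] assms by (auto intro!: T[of _ _ \<beta>])
  ultimately show "(if \<alpha> - \<beta> \<in> P then T \<beta> (\<alpha> - \<beta>)
      else if \<alpha> - \<beta> \<in> uminus ` P then T \<alpha> (\<beta> - \<alpha>) else 0) = - c \<beta> (- \<alpha>)"
    and "(if \<alpha> - \<beta> \<in> P then T (\<alpha> - \<beta>) \<beta>
      else if \<alpha> - \<beta> \<in> uminus ` P then T (\<beta> - \<alpha>) \<alpha> else 0) = c \<beta> (- \<alpha>)"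
    using c_diff[OF assms(2,3,4)] by simp_all
qed

text \<open>\<open>c_jacobi\<close> for \<zeta>, \<eta>, - \<gamma>, - \<delta>, brought to the
  shape \<open>c \<beta> (- \<alpha>)\<close> that \<open>table_diff\<close> delivers. The
  inequalities are guaranteed by \<open>other_pairs\<close>.\<close>

lemma c_other_pair:
  assumes "\<zeta> \<in> P" "\<eta> \<in> P" "\<gamma> \<in> P" "\<delta> \<in> P" "\<gamma> + \<delta> = \<zeta> + \<eta>" "\<gamma> \<noteq> \<zeta>" "\<gamma> \<noteq> \<eta>" "\<delta> \<noteq> \<zeta>"
  shows "c \<zeta> \<eta> * c \<gamma> \<delta> = c \<eta> (- \<gamma>) * c \<delta> (- \<zeta>) - c \<gamma> (- \<zeta>) * c \<eta> (- \<delta>)"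
proof -
  note r = assms(1-4)[THEN positive_root]
  note nr = r[THEN uminus_root]
  have 0: "\<zeta> + \<eta> + - \<gamma> + - \<delta> = 0"
    using assms(5) by (simp add: algebra_simps)
  have ne: "\<zeta> + \<eta> \<noteq> 0" "\<eta> + - \<gamma> \<noteq> 0" "- \<gamma> + \<zeta> \<noteq> 0" "\<gamma> + \<delta> \<noteq> 0" "\<gamma> + - \<zeta> \<noteq> 0" "\<delta> + - \<zeta> \<noteq> 0"
    using assms sum_positive_nonzero by auto
  have "c \<zeta> \<eta> * c (- \<gamma>) (- \<delta>) + c \<eta> (- \<gamma>) * c \<zeta> (- \<delta>) + c (- \<gamma>) \<zeta> * c \<eta> (- \<delta>) = 0"
    by (rule c_jacobi) (use r nr 0 ne in auto)
  moreover have "c (- \<gamma>) (- \<delta>) = - c \<gamma> \<delta>"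
    using r ne by (intro c_uminus)
  moreover have "c (- \<gamma>) \<zeta> = - c \<gamma> (- \<zeta>)"
    using c_uminus[of \<gamma> "- \<zeta>"] r nr ne by simp
  moreover have "c \<zeta> (- \<delta>) = - c (- \<delta>) \<zeta>"
    using r nr ne by (intro c_anti) auto
  moreover have "c (- \<delta>) \<zeta> = - c \<delta> (- \<zeta>)"
    using c_uminus[of \<delta> "- \<zeta>"] r nr ne by simp
  ultimately show ?thesis by (simp add: algebra_simps)
qed

lemma correct_pair_step:
  assumes T: "settled (l - 1) \<subseteq> correct T" "(\<zeta>, \<eta>) \<in> correct T"
    and ze: "\<zeta> \<in> P" "\<eta> \<in> P" "c \<zeta> \<eta> \<noteq> 0" "lev (\<zeta> + \<eta>) = l"
    and gd: "(\<gamma>, \<delta>) \<in> other_pairs P \<zeta> \<eta> (\<zeta> + \<eta>)"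
  shows "insert (\<gamma>, \<delta>) (correct T) \<subseteq> correct (pair_step P \<zeta> \<eta> (\<gamma>, \<delta>) T)"
proof -
  have g: "\<gamma> \<in> P" "\<delta> \<in> P" "\<gamma> + \<delta> = \<zeta> + \<eta>" "\<gamma> \<noteq> \<zeta>" "\<gamma> \<noteq> \<eta>" "\<delta> \<noteq> \<zeta>" "\<delta> \<noteq> \<eta>"
    using gd by (auto simp: other_pairs_def)
  have "lev \<gamma> + lev \<delta> = l" "lev \<zeta> + lev \<eta> = l"
    using ze g level_add by metis+
  then have lev: "lev \<gamma> < l" "lev \<delta> < l" "lev \<zeta> < l" "lev \<eta> < l"
    using level_positive[OF g(1)] level_positive[OF g(2)] level_positive[OF ze(1)] level_positive[OF ze(2)]
    by auto
  have "T \<zeta> \<eta> = c \<zeta> \<eta>" using T(2) by (simp add: correct_def)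
  moreover have "- c \<eta> (- \<gamma>) * - c \<delta> (- \<zeta>) + c \<gamma> (- \<zeta>) * - c \<eta> (- \<delta>) = c \<zeta> \<eta> * c \<gamma> \<delta>"
    using c_other_pair[OF ze(1,2) g(1-6)] by simp
  ultimately have v: "1 / T \<zeta> \<eta> * (- c \<eta> (- \<gamma>) * - c \<delta> (- \<zeta>) + c \<gamma> (- \<zeta>) * - c \<eta> (- \<delta>)) = c \<gamma> \<delta>"
    by (simp only:) (simp add: ze(3))
  \<comment> \<open>The four rewrites evaluate, in this order, \<open>c11\<close>,
    \<open>c12\<close>, \<open>c21\<close> and \<open>c22\<close>.\<close>
  have "pair_step P \<zeta> \<eta> (\<gamma>, \<delta>) T = set_entry \<gamma> \<delta>
      (1 / T \<zeta> \<eta> * (- c \<eta> (- \<gamma>) * - c \<delta> (- \<zeta>) + c \<gamma> (- \<zeta>) * - c \<eta> (- \<delta>))) T"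
    unfolding pair_step_def prod.case Let_def
      table_diff(1)[OF T(1) g(1) ze(2) g(5) lev(1,4)] table_diff(1)[OF T(1) ze(1) g(2) g(6)[symmetric] lev(3,2)]
      table_diff(2)[OF T(1) ze(1) g(1) g(4)[symmetric] lev(3,1)] table_diff(1)[OF T(1) g(2) ze(2) g(7) lev(2,4)] ..
  then show ?thesis unfolding v using correct_set_entry[OF refl] by simp
qed

lemma correct_decomposition_step:
  assumes "\<zeta> \<in> P" "\<eta> \<in> P" "\<zeta> + \<eta> \<in> P" "c \<zeta> \<eta> > 0"
  shows "correct T \<union> {(\<zeta>, \<eta>), (\<eta>, \<zeta>)} \<subseteq> correct (decomposition_step \<Delta> (root_inner br t) \<zeta> \<eta> T)"
proof -
  note r = assms(1-3)[THEN positive_root]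
  have "decomposition_step \<Delta> (root_inner br t) \<zeta> \<eta> T =
    set_entry \<eta> \<zeta> (- c \<zeta> \<eta>) (set_entry \<zeta> \<eta> (c \<zeta> \<eta>) T)"
    using decomposition_constant[OF r] assms(4) by (simp only: decomposition_step_def Let_def less_imp_le)
  moreover have "c \<eta> \<zeta> = - c \<zeta> \<eta>"
    using r sum_positive_nonzero[OF assms(1,2)] by (intro c_anti)
  ultimately show ?thesis
    using correct_set_entry[of "c \<zeta> \<eta>" \<zeta> \<eta> T]
      correct_set_entry[of "- c \<zeta> \<eta>" \<eta> \<zeta> "set_entry \<zeta> \<eta> (c \<zeta> \<eta>) T"] by auto
qed

text \<open>A loop rule with two roles: \<open>B\<close> collects entries that each pass may rely
  on, \<open>E x\<close> those it contributes. As no pass spoils a correct entry, \<open>B\<close>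
  stays available and the contributions accumulate in any order.\<close>

lemma correct_fold:
  assumes "\<And>x T. x \<in> set xs \<Longrightarrow> B \<subseteq> correct T \<Longrightarrow> correct T \<union> E x \<subseteq> correct (f x T)"
    and "B \<subseteq> correct T"
  shows "correct T \<union> (\<Union>x\<in>set xs. E x) \<subseteq> correct (fold f xs T)"
  using assms
proof (induction xs arbitrary: T)
  case (Cons x xs)
  have x: "correct T \<union> E x \<subseteq> correct (f x T)"
    using Cons.prems by simp
  then have "B \<subseteq> correct (f x T)" using Cons.prems(2) by blast
  then have "correct (f x T) \<union> (\<Union>x\<in>set xs. E x) \<subseteq> correct (fold f xs (f x T))"
    by (rule Cons.IH[rotated]) (use Cons.prems(1) in simp)
  then show ?case using x by auto
qed simp

end

locale chevalley_decomposition = chevalley_base br t X c \<Psi>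
  for br :: "'g::real_vector \<Rightarrow> 'g \<Rightarrow> 'g" and t X c \<Psi> +
  fixes \<zeta> \<eta> :: "'g weight \<Rightarrow> 'g weight"
  assumes decomposition: "\<alpha> \<in> P - \<Psi> \<Longrightarrow> \<zeta> \<alpha> \<in> P \<and> \<eta> \<alpha> \<in> P \<and> \<alpha> = \<zeta> \<alpha> + \<eta> \<alpha>"
    and positive_constant: "\<alpha> \<in> P - \<Psi> \<Longrightarrow> c (\<zeta> \<alpha>) (\<eta> \<alpha>) > 0"
begin

lemma correct_root_loop:
  assumes l: "l \<ge> 2" and ro: "set rs = {\<alpha> \<in> P. lev \<alpha> = l}"
    and po: "\<And>\<alpha>. \<alpha> \<in> P \<Longrightarrow> lev \<alpha> \<ge> 2 \<Longrightarrow> set (po \<alpha>) = other_pairs P (\<zeta> \<alpha>) (\<eta> \<alpha>) \<alpha>"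
    and T: "settled (l - 1) \<subseteq> correct T"
  shows "settled l \<subseteq> correct (root_loop \<Delta> P (root_inner br t) \<zeta> \<eta> po rs T)"
proof -
  define E where "E = (\<lambda>\<alpha>. {(\<gamma>, \<delta>) \<in> P \<times> P. \<gamma> + \<delta> = \<alpha>})"
  have "correct T \<union> (\<Union>\<alpha>\<in>set rs. E \<alpha>) \<subseteq> correct (root_loop \<Delta> P (root_inner br t) \<zeta> \<eta> po rs T)"
    unfolding root_loop_def
  proof (rule correct_fold[OF _ T])
    fix \<alpha> T assume "\<alpha> \<in> set rs" and T: "settled (l - 1) \<subseteq> correct T"
    then have \<alpha>: "\<alpha> \<in> P" "lev \<alpha> = l" using ro by auto
    then have n: "\<alpha> \<in> P - \<Psi>" using level_simple[of \<alpha>] l by auto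
    note d = decomposition[OF n] and pos = positive_constant[OF n]
    define T' where "T' = decomposition_step \<Delta> (root_inner br t) (\<zeta> \<alpha>) (\<eta> \<alpha>) T"
    have T': "correct T \<union> {(\<zeta> \<alpha>, \<eta> \<alpha>), (\<eta> \<alpha>, \<zeta> \<alpha>)} \<subseteq> correct T'"
      unfolding T'_def using d pos \<alpha> by (intro correct_decomposition_step) auto
    have "correct T' \<union> (\<Union>x\<in>set (po \<alpha>). {x}) \<subseteq> correct (fold (pair_step P (\<zeta> \<alpha>) (\<eta> \<alpha>)) (po \<alpha>) T')"
    proof (rule correct_fold)
      \<comment> \<open>Besides the lower levels the pair loop reads the entry at \<zeta>, \<eta>
        that (C5) has just written.\<close>
      show "settled (l - 1) \<union> {(\<zeta> \<alpha>, \<eta> \<alpha>)} \<subseteq> correct T'" using T T' by blast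
      fix x T assume "x \<in> set (po \<alpha>)" and T: "settled (l - 1) \<union> {(\<zeta> \<alpha>, \<eta> \<alpha>)} \<subseteq> correct T"
      then have x: "x \<in> other_pairs P (\<zeta> \<alpha>) (\<eta> \<alpha>) (\<zeta> \<alpha> + \<eta> \<alpha>)"
        using po[OF \<alpha>(1)] \<alpha>(2) l d by auto
      obtain \<gamma> \<delta> where gd: "x = (\<gamma>, \<delta>)" by fastforce
      have "insert (\<gamma>, \<delta>) (correct T) \<subseteq> correct (pair_step P (\<zeta> \<alpha>) (\<eta> \<alpha>) (\<gamma>, \<delta>) T)"
      proof (rule correct_pair_step)
        show "settled (l - 1) \<subseteq> correct T" "(\<zeta> \<alpha>, \<eta> \<alpha>) \<in> correct T" using T by auto
        show "lev (\<zeta> \<alpha> + \<eta> \<alpha>) = l" using \<alpha>(2) d by simp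
        show "(\<gamma>, \<delta>) \<in> other_pairs P (\<zeta> \<alpha>) (\<eta> \<alpha>) (\<zeta> \<alpha> + \<eta> \<alpha>)" using x gd by simp
      qed (use d pos in auto)
      then show "correct T \<union> {x} \<subseteq> correct (pair_step P (\<zeta> \<alpha>) (\<eta> \<alpha>) x T)"
        unfolding gd by blast
    qed
    \<comment> \<open>If one member of a pair is \<zeta> or \<eta>, the sum forces the other, so
      (C5) and (C6) together reach every decomposition of \<alpha>.\<close>
    moreover have "E \<alpha> \<subseteq> {(\<zeta> \<alpha>, \<eta> \<alpha>), (\<eta> \<alpha>, \<zeta> \<alpha>)} \<union> set (po \<alpha>)"
    proof (rule subsetI)
      fix x assume "x \<in> E \<alpha>"
      then obtain \<gamma> \<delta> where x: "x = (\<gamma>, \<delta>)" and g: "\<gamma> \<in> P" "\<delta> \<in> P" "\<gamma> + \<delta> = \<alpha>"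
        by (auto simp: E_def)
      have e: "\<gamma> + \<delta> = \<zeta> \<alpha> + \<eta> \<alpha>" using g d by simp
      consider "\<gamma> = \<zeta> \<alpha>" | "\<gamma> = \<eta> \<alpha>" | "\<delta> = \<zeta> \<alpha>" | "\<delta> = \<eta> \<alpha>"
        | "\<gamma> \<notin> {\<zeta> \<alpha>, \<eta> \<alpha>}" "\<delta> \<notin> {\<zeta> \<alpha>, \<eta> \<alpha>}" by blast
      then show "x \<in> {(\<zeta> \<alpha>, \<eta> \<alpha>), (\<eta> \<alpha>, \<zeta> \<alpha>)} \<union> set (po \<alpha>)"
      proof cases
        case 5
        then have "(\<gamma>, \<delta>) \<in> other_pairs P (\<zeta> \<alpha>) (\<eta> \<alpha>) \<alpha>"
          using g by (simp add: other_pairs_def)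
        then show ?thesis using po[OF \<alpha>(1)] \<alpha>(2) l x by simp
      qed (use e in \<open>simp_all add: x add.commute\<close>)
    qed
    ultimately show "correct T \<union> E \<alpha> \<subseteq> correct (fold (pair_step P (\<zeta> \<alpha>) (\<eta> \<alpha>)) (po \<alpha>)
        (decomposition_step \<Delta> (root_inner br t) (\<zeta> \<alpha>) (\<eta> \<alpha>) T))"
      using T' unfolding T'_def[symmetric] by auto
  qed
  moreover have "settled l \<subseteq> settled (l - 1) \<union> (\<Union>\<alpha>\<in>set rs. E \<alpha>)"
    unfolding ro by (auto simp: settled_def E_def)
  ultimately show ?thesis using T by blast
qed

lemma run_correct:
  assumes "chevalley_run br t \<Psi> \<zeta> \<eta> T T'"
  shows "P \<times> P \<subseteq> correct T'"
proof -
  define L where "L = Max (lev ` \<Delta>)"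
  obtain ro po where ro: "\<forall>l\<in>{2..L}. distinct (ro l) \<and> set (ro l) = {\<alpha>\<in>P. lev \<alpha> = l}"
    and po: "\<forall>\<alpha>\<in>P. lev \<alpha> \<ge> 2 \<longrightarrow>
      distinct (po \<alpha>) \<and> set (po \<alpha>) = other_pairs P (\<zeta> \<alpha>) (\<eta> \<alpha>) \<alpha>"
    and T': "T' = fold (\<lambda>l. root_loop \<Delta> P (root_inner br t) \<zeta> \<eta> po (ro l)) [2..L] (init_table P T)"
    using assms unfolding chevalley_run_def Let_def L_def by blast
  \<comment> \<open>\<open>max 1 L\<close> covers an empty root system, where \<open>L\<close> is
    the unspecified maximum of the empty set and may be below 1.\<close>
  have loop: "settled n \<subseteq> correct (fold (\<lambda>l. root_loop \<Delta> P (root_inner br t) \<zeta> \<eta> po (ro l)) [2..n] (init_table P T))"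
    if "1 \<le> n" "n \<le> max 1 L" for n
    using that
  proof (induction n rule: int_ge_induct)
    case base
    then show ?case using settled_init by simp
  next
    case (step n)
    have "[2..n + 1] = [2..n] @ [n + 1]"
      using step.hyps by (simp add: upto_rec2)
    moreover have "settled (n + 1) \<subseteq> correct (root_loop \<Delta> P (root_inner br t) \<zeta> \<eta> po (ro (n + 1))
      (fold (\<lambda>l. root_loop \<Delta> P (root_inner br t) \<zeta> \<eta> po (ro l)) [2..n] (init_table P T)))"
      using step ro po by (intro correct_root_loop) auto
    ultimately show ?case by simp
  qed
  have "[2..max 1 L] = [2..L]" by (cases "L \<ge> 1") auto
  then have "settled (max 1 L) \<subseteq> correct T'"
    using loop[of "max 1 L"] by (simp add: T')
  moreover have "lev \<alpha> \<le> L" if "\<alpha> \<in> P" for \<alpha>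
    unfolding L_def using positive_root[OF that] finite_roots by (intro Max_ge) auto
  then have "P \<times> P \<subseteq> settled (max 1 L)"
    by (auto simp: settled_def le_max_iff_disj)
  ultimately show ?thesis by blast
qed

text \<open>Finiteness of the positive roots yields enumerations for both loops, so that correctness
  of all executions is not vacuous.\<close>

lemma run_exists: "\<exists>T'. chevalley_run br t \<Psi> \<zeta> \<eta> T T'"
proof -
  have "\<exists>xs. distinct xs \<and> set xs = {\<alpha>\<in>P. lev \<alpha> = l}" for l
    using finite_distinct_list[of "{\<alpha>\<in>P. lev \<alpha> = l}"] finite_positive by auto
  then obtain ro where ro: "\<And>l. distinct (ro l) \<and> set (ro l) = {\<alpha>\<in>P. lev \<alpha> = l}" by metis
  have "other_pairs P (\<zeta> \<alpha>) (\<eta> \<alpha>) \<alpha> \<subseteq> P \<times> P" for \<alpha> by (auto simp: other_pairs_def)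
  then have "finite (other_pairs P (\<zeta> \<alpha>) (\<eta> \<alpha>) \<alpha>)" for \<alpha>
    using finite_positive by (meson finite_SigmaI finite_subset)
  then have "\<exists>xs. distinct xs \<and> set xs = other_pairs P (\<zeta> \<alpha>) (\<eta> \<alpha>) \<alpha>" for \<alpha>
    using finite_distinct_list by metis
  then obtain po where "\<And>\<alpha>. distinct (po \<alpha>) \<and> set (po \<alpha>) = other_pairs P (\<zeta> \<alpha>) (\<eta> \<alpha>) \<alpha>" by metis
  then show ?thesis
    unfolding chevalley_run_def Let_def using ro by blast
qed

end

theorem mainTheorem8:
  fixes br :: "'g::real_vector \<Rightarrow> 'g \<Rightarrow> 'g"
    and t :: "'g set"
    and \<Psi> :: "'g weight set"
    and \<zeta> \<eta> :: "'g weight \<Rightarrow> 'g weight"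
    and X :: "'g weight \<Rightarrow> 'g cplx"
    and c :: "'g weight \<Rightarrow> 'g weight \<Rightarrow> real"
  defines "\<Delta> \<equiv> roots br t"
  defines "\<Delta>p \<equiv> positive_roots \<Delta> \<Psi>"
  assumes "compact_lie_algebra br"
    and "cartan_subalgebra br t"
    and "root_base \<Delta> \<Psi>"
    and "\<And>\<alpha>. \<alpha> \<in> \<Delta>p - \<Psi> \<Longrightarrow> \<zeta> \<alpha> \<in> \<Delta>p \<and> \<eta> \<alpha> \<in> \<Delta>p \<and> \<alpha> = \<zeta> \<alpha> + \<eta> \<alpha>"
    and "chevalley_basis br t X c"
    and "\<And>\<alpha>. \<alpha> \<in> \<Delta>p \<Longrightarrow> X (- \<alpha>) = - conjugate (X \<alpha>)"
    and "\<And>\<alpha>. \<alpha> \<in> \<Delta>p - \<Psi> \<Longrightarrow> c (\<zeta> \<alpha>) (\<eta> \<alpha>) > 0"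
  shows "\<forall>c0. (\<exists>c'. chevalley_run br t \<Psi> \<zeta> \<eta> c0 c') \<and>
    (\<forall>c'. chevalley_run br t \<Psi> \<zeta> \<eta> c0 c' \<longrightarrow> (\<forall>\<alpha>\<in>\<Delta>p. \<forall>\<beta>\<in>\<Delta>p. c' \<alpha> \<beta> = c \<alpha> \<beta>))"
proof -
  have "subspace t"
    using assms(4) by (auto simp: cartan_subalgebra_def nilpotent_subalgebra_def lie_subalgebra_def)
  then interpret chevalley_decomposition br t X c \<Psi> \<zeta> \<eta>
    using assms(3,5-7,9) unfolding \<Delta>_def \<Delta>p_def by unfold_locales auto
  show ?thesis
    unfolding \<Delta>_def \<Delta>p_def using run_exists run_correct by (fastforce simp: correct_def)
qed

end
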